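(* Let $\mathbb{W}=m_1P_1+\cdots+m_sP_s$ be a fat point scheme in $\mathbb{P}^n$ supported at a set of points $\mathbb{X}=\{P_1,\dots,P_s\}$, and let $\mathbb{Y}$ be the subscheme $\mathbb{Y}=(m_1-1)P_1+\cdots+(m_s-1)P_s$ of $\mathbb{W}$. Suppose that $\mathbb{X}$ is contained in a hyperplane. Then $$\Omega^{n+1}_{R_{\mathbb{W}}/K}\cong R_{\mathbb{Y}}(-n-1).$$ In particular, $\mathrm{HF}_{\Omega^{n+1}_{R_{\mathbb{W}}/K}}(i)=\mathrm{HF}_{\mathbb{Y}}(i-n-1)$ for all $i\in\mathbb{Z}$.
   Context: $K$ is a field of characteristic zero, $S=K[X_0,\dots,X_n]$ ($n\ge1$) with the standard grading is the homogeneous coordinate ring of $\mathbb{P}^n$ over $K$. Given distinct $K$-rational points $P_1,\dots,P_s\in\mathbb{P}^n$ ($s\ge1$, coordinates chosen so that none lies on $X_0=0$) with homogeneous vanishing ideals $\wp_1,\dots,\wp_s\subseteq S$ and positive integers $m_1,\dots,m_s$, the fat point scheme $\mathbb{W}=m_1P_1+\cdots+m_sP_s$ is the $0$-dimensional subscheme of $\mathbb{P}^n$ with homogeneous vanishing ideal $I_{\mathbb{W}}=\wp_1^{m_1}\cap\cdots\cap\wp_s^{m_s}$; $R_{\mathbb{W}}=S/I_{\mathbb{W}}$. Likewise $I_{\mathbb{Y}}=\wp_1^{m_1-1}\cap\cdots\cap\wp_s^{m_s-1}$ with $\wp_j^0=S$, and $R_{\mathbb{Y}}=S/I_{\mathbb{Y}}$,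 with Hilbert function $\mathrm{HF}_{\mathbb{Y}}$. $\Omega^1_{R_{\mathbb{W}}/K}$ is the module of Kähler differentials of $R_{\mathbb{W}}/K$, graded with $\deg(dx_i)=1$ where $x_i$ is the image of $X_i$, and $\Omega^{m}_{R_{\mathbb{W}}/K}=\bigwedge^{m}_{R_{\mathbb{W}}}\Omega^1_{R_{\mathbb{W}}/K}$. The isomorphism is one of graded $R_{\mathbb{W}}$-modules, $M(a)_i=M_{a+i}$, and $\mathrm{HF}_M(i)=\dim_K M_i$. *)

theory Defs
  imports
    "HOL-Algebra.Module" "HOL-Algebra.QuotRing" "HOL-Algebra.Ideal_Product"
    "HOL-Algebra.Generated_Groups" "HOL-Library.Poly_Mapping"
begin

section \<open>Modules given by generators and relations\<close>

text \<open>
  The fields \<open>mult\<close> and \<open>one\<close> of a module record play no role (the locale \<open>module\<close>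
  does not constrain them); free and quotient modules leave them \<open>undefined\<close>.
\<close>

definition free_module :: "('r, 'x) ring_scheme \<Rightarrow> 'b set \<Rightarrow> ('r, 'b \<Rightarrow> 'r) module" where
  "free_module R B =
    \<lparr>carrier = {f \<in> B \<rightarrow>\<^sub>E carrier R. finite {b \<in> B. f b \<noteq> \<zero>\<^bsub>R\<^esub>}},
     mult = undefined, one = undefined,
     zero = (\<lambda>b\<in>B. \<zero>\<^bsub>R\<^esub>),
     add = (\<lambda>f g. \<lambda>b\<in>B. f b \<oplus>\<^bsub>R\<^esub> g b),
     smult = (\<lambda>r f. \<lambda>b\<in>B. r \<otimes>\<^bsub>R\<^esub> f b)\<rparr>"

definition free_gen :: "('r, 'x) ring_scheme \<Rightarrow> 'b set \<Rightarrow> 'b \<Rightarrow> 'b \<Rightarrow> 'r" where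
  "free_gen R B a = (\<lambda>b\<in>B. if b = a then \<one>\<^bsub>R\<^esub> else \<zero>\<^bsub>R\<^esub>)"

definition gen_submodule :: "('r, 'x) ring_scheme \<Rightarrow> ('r, 'm, 'y) module_scheme \<Rightarrow> 'm set \<Rightarrow> 'm set"
  where "gen_submodule R M G = \<Inter>{N. submodule N R M \<and> G \<subseteq> N}"

definition quot_module :: "('r, 'm, 'y) module_scheme \<Rightarrow> 'm set \<Rightarrow> ('r, 'm set) module" where
  "quot_module M N =
    \<lparr>carrier = a_rcosets\<^bsub>M\<^esub> N,
     mult = undefined, one = undefined,
     zero = N,
     add = set_add M,
     smult = (\<lambda>r X. \<Union>x\<in>X. N +>\<^bsub>M\<^esub> (r \<odot>\<^bsub>M\<^esub> x))\<rparr>"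

definition self_module :: "('r, 'x) ring_scheme \<Rightarrow> ('r, 'r) module" where
  "self_module R =
    \<lparr>carrier = carrier R, mult = mult R, one = one R, zero = zero R, add = add R,
     smult = mult R\<rparr>"

definition restrict_scalars :: "('q \<Rightarrow> 'r) \<Rightarrow> ('r, 'm) module \<Rightarrow> ('q, 'm) module" where
  "restrict_scalars h M =
    \<lparr>carrier = carrier M, mult = mult M, one = one M, zero = zero M, add = add M,
     smult = (\<lambda>a x. h a \<odot>\<^bsub>M\<^esub> x)\<rparr>"


section \<open>Kaehler differentials\<close>

text \<open>
  For a commutative ring \<open>R\<close> and a set \<open>A\<close> of constants (the image of the base ring), the
  module of differentials is free on symbols \<open>d a\<close>, \<open>a \<in> R\<close>, modulo additivity, the
  Leibniz rule and \<open>d c = 0\<close> for \<open>c \<in> A\<close>.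
\<close>

definition kaehler_relations :: "('r, 'x) ring_scheme \<Rightarrow> 'r set \<Rightarrow> ('r \<Rightarrow> 'r) set" where
  "kaehler_relations R A =
    (let F = free_module R (carrier R); D = free_gen R (carrier R) in
      {D (a \<oplus>\<^bsub>R\<^esub> b) \<ominus>\<^bsub>F\<^esub> (D a \<oplus>\<^bsub>F\<^esub> D b) | a b. a \<in> carrier R \<and> b \<in> carrier R}
      \<union> {D (a \<otimes>\<^bsub>R\<^esub> b) \<ominus>\<^bsub>F\<^esub> (a \<odot>\<^bsub>F\<^esub> D b \<oplus>\<^bsub>F\<^esub> b \<odot>\<^bsub>F\<^esub> D a) | a b. a \<in> carrier R \<and> b \<in> carrier R}
      \<union> D ` A)"

definition kaehler_submodule :: "('r, 'x) ring_scheme \<Rightarrow> 'r set \<Rightarrow> ('r \<Rightarrow> 'r) set" where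
  "kaehler_submodule R A =
    gen_submodule R (free_module R (carrier R)) (kaehler_relations R A)"

definition kaehler :: "('r, 'x) ring_scheme \<Rightarrow> 'r set \<Rightarrow> ('r, ('r \<Rightarrow> 'r) set) module" where
  "kaehler R A = quot_module (free_module R (carrier R)) (kaehler_submodule R A)"

definition kaehler_d :: "('r, 'x) ring_scheme \<Rightarrow> 'r set \<Rightarrow> 'r \<Rightarrow> ('r \<Rightarrow> 'r) set" where
  "kaehler_d R A a =
    kaehler_submodule R A +>\<^bsub>free_module R (carrier R)\<^esub> free_gen R (carrier R) a"


section \<open>Exterior powers\<close>

text \<open>
  The \<open>q\<close>-th exterior power of \<open>M\<close> is the free module on the \<open>q\<close>-tuples of elements
  of \<open>M\<close> modulo multilinearity and the vanishing of tuples with a repeated entry.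
\<close>

definition tuples :: "'m set \<Rightarrow> nat \<Rightarrow> 'm list set" where
  "tuples X q = {xs. length xs = q \<and> set xs \<subseteq> X}"

definition wedge_relations ::
  "('r, 'x) ring_scheme \<Rightarrow> nat \<Rightarrow> ('r, 'm, 'y) module_scheme \<Rightarrow> ('m list \<Rightarrow> 'r) set" where
  "wedge_relations R q M =
    (let T = tuples (carrier M) q; F = free_module R T; e = free_gen R T in
      {e (xs[i := x \<oplus>\<^bsub>M\<^esub> y]) \<ominus>\<^bsub>F\<^esub> (e (xs[i := x]) \<oplus>\<^bsub>F\<^esub> e (xs[i := y])) | xs i x y.
         xs \<in> T \<and> i < q \<and> x \<in> carrier M \<and> y \<in> carrier M}
      \<union> {e (xs[i := r \<odot>\<^bsub>M\<^esub> x]) \<ominus>\<^bsub>F\<^esub> r \<odot>\<^bsub>F\<^esub> e (xs[i := x]) | xs i r x.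
         xs \<in> T \<and> i < q \<and> r \<in> carrier R \<and> x \<in> carrier M}
      \<union> {e xs | xs i j. xs \<in> T \<and> i < j \<and> j < q \<and> xs ! i = xs ! j})"

definition wedge_submodule ::
  "('r, 'x) ring_scheme \<Rightarrow> nat \<Rightarrow> ('r, 'm, 'y) module_scheme \<Rightarrow> ('m list \<Rightarrow> 'r) set" where
  "wedge_submodule R q M =
    gen_submodule R (free_module R (tuples (carrier M) q)) (wedge_relations R q M)"

definition ext_power ::
  "('r, 'x) ring_scheme \<Rightarrow> nat \<Rightarrow> ('r, 'm, 'y) module_scheme \<Rightarrow> ('r, ('m list \<Rightarrow> 'r) set) module"
  where
  "ext_power R q M = quot_module (free_module R (tuples (carrier M) q)) (wedge_submodule R q M)"

definition wedge ::
  "('r, 'x) ring_scheme \<Rightarrow> ('r, 'm, 'y) module_scheme \<Rightarrow> 'm list \<Rightarrow> ('m list \<Rightarrow> 'r) set" where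
  "wedge R M xs =
    (let T = tuples (carrier M) (length xs) in
      wedge_submodule R (length xs) M +>\<^bsub>free_module R T\<^esub> free_gen R T xs)"


section \<open>Gradings and Hilbert functions\<close>

text \<open>
  A grading of a module is given by its family of homogeneous components, indexed by \<open>\<int>\<close>.
\<close>

definition ext_grade ::
  "('r, 'x) ring_scheme \<Rightarrow> nat \<Rightarrow> ('r, 'm, 'y) module_scheme \<Rightarrow> (int \<Rightarrow> 'm set)
    \<Rightarrow> int \<Rightarrow> ('m list \<Rightarrow> 'r) set set" where
  "ext_grade R q M G i =
    generate (add_monoid (ext_power R q M))
      {wedge R M xs | xs ds. length xs = q \<and> length ds = q
         \<and> (\<forall>k<q. xs ! k \<in> G (ds ! k)) \<and> sum_list ds = i}"

definition grade_shift :: "(int \<Rightarrow> 'm set) \<Rightarrow> int \<Rightarrow> int \<Rightarrow> 'm set" where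
  "grade_shift G a i = G (a + i)"

definition graded_module_iso ::
  "('r, 'x) ring_scheme \<Rightarrow> ('r, 'm, 'y) module_scheme \<Rightarrow> (int \<Rightarrow> 'm set)
    \<Rightarrow> ('r, 'n, 'z) module_scheme \<Rightarrow> (int \<Rightarrow> 'n set) \<Rightarrow> bool" where
  "graded_module_iso R M G N H \<longleftrightarrow>
    (\<exists>f. bij_betw f (carrier M) (carrier N)
       \<and> (\<forall>x\<in>carrier M. \<forall>y\<in>carrier M. f (x \<oplus>\<^bsub>M\<^esub> y) = f x \<oplus>\<^bsub>N\<^esub> f y)
       \<and> (\<forall>r\<in>carrier R. \<forall>x\<in>carrier M. f (r \<odot>\<^bsub>M\<^esub> x) = r \<odot>\<^bsub>N\<^esub> f x)
       \<and> (\<forall>i. f ` G i = H i))"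

text \<open>
  Dimension over the field \<open>'k\<close> of a subspace \<open>V\<close> of a module, with \<open>c \<in> 'k\<close> acting as the
  ring element \<open>sc c\<close>: the cardinality of a finite basis. Unspecified when \<open>V\<close> is
  infinite-dimensional.
\<close>

definition is_finite_basis ::
  "('k \<Rightarrow> 'r) \<Rightarrow> ('r, 'm, 'y) module_scheme \<Rightarrow> 'm set \<Rightarrow> 'm set \<Rightarrow> bool" where
  "is_finite_basis sc M V B \<longleftrightarrow> finite B \<and> B \<subseteq> V \<and>
    (\<forall>v\<in>V. \<exists>!c. c \<in> B \<rightarrow>\<^sub>E UNIV \<and> v = (\<Oplus>\<^bsub>M\<^esub>b\<in>B. sc (c b) \<odot>\<^bsub>M\<^esub> b))"

definition vdim :: "('k \<Rightarrow> 'r) \<Rightarrow> ('r, 'm, 'y) module_scheme \<Rightarrow> 'm set \<Rightarrow> nat" where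
  "vdim sc M V = (THE d. \<exists>B. is_finite_basis sc M V B \<and> card B = d)"

definition hilbert_function ::
  "('k \<Rightarrow> 'r) \<Rightarrow> ('r, 'm, 'y) module_scheme \<Rightarrow> (int \<Rightarrow> 'm set) \<Rightarrow> int \<Rightarrow> nat" where
  "hilbert_function sc M G i = vdim sc M (G i)"


section \<open>The polynomial ring and homogeneous coordinate rings\<close>

text \<open>
  A monomial is its exponent vector; \<open>K[X\<^sub>0, \<dots>, X\<^sub>n]\<close> consists of the polynomials in
  \<open>X\<^sub>0, X\<^sub>1, \<dots>\<close> all of whose monomials involve only variables of index at most \<open>n\<close>.
\<close>

type_synonym 'k mpoly = "(nat \<Rightarrow>\<^sub>0 nat) \<Rightarrow>\<^sub>0 'k"

definition poly_ring :: "nat \<Rightarrow> 'k::field mpoly ring" where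
  "poly_ring n =
    \<lparr>carrier = {F. \<forall>\<alpha>\<in>Poly_Mapping.keys F. Poly_Mapping.keys \<alpha> \<subseteq> {..n}},
     mult = (*), one = 1, zero = 0, add = (+)\<rparr>"

definition poly_const :: "'k::field \<Rightarrow> 'k mpoly" where
  "poly_const c = Poly_Mapping.single 0 c"

definition poly_var :: "nat \<Rightarrow> 'k::field mpoly" where
  "poly_var i = Poly_Mapping.single (Poly_Mapping.single i 1) 1"

definition poly_eval :: "nat \<Rightarrow> (nat \<Rightarrow> 'k::field) \<Rightarrow> 'k mpoly \<Rightarrow> 'k" where
  "poly_eval n p F =
    (\<Sum>\<alpha>\<in>Poly_Mapping.keys F.
      Poly_Mapping.lookup F \<alpha> * (\<Prod>i\<le>n. p i ^ Poly_Mapping.lookup \<alpha> i))"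

definition homog_part :: "nat \<Rightarrow> int \<Rightarrow> 'k::field mpoly set" where
  "homog_part n d = {F \<in> carrier (poly_ring n).
    \<forall>\<alpha>\<in>Poly_Mapping.keys F. int (\<Sum>i\<le>n. Poly_Mapping.lookup \<alpha> i) = d}"

definition coord_ring :: "nat \<Rightarrow> 'k::field mpoly set \<Rightarrow> 'k mpoly set ring" where
  "coord_ring n I = poly_ring n Quot I"

definition coord_class :: "nat \<Rightarrow> 'k::field mpoly set \<Rightarrow> 'k mpoly \<Rightarrow> 'k mpoly set" where
  "coord_class n I F = I +>\<^bsub>poly_ring n\<^esub> F"

definition coord_scalar :: "nat \<Rightarrow> 'k::field mpoly set \<Rightarrow> 'k \<Rightarrow> 'k mpoly set" where
  "coord_scalar n I c = coord_class n I (poly_const c)"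

definition coord_grade :: "nat \<Rightarrow> 'k::field mpoly set \<Rightarrow> int \<Rightarrow> 'k mpoly set set" where
  "coord_grade n I i = coord_class n I ` homog_part n i"

text \<open>
  For ideals \<open>I \<subseteq> J\<close>, the ring \<open>S/J\<close> as a module over \<open>S/I\<close> along the canonical surjection,
  which sends a coset \<open>x\<close> of \<open>I\<close> to the coset \<open>J + x\<close> of \<open>J\<close>.
\<close>

definition coord_module ::
  "nat \<Rightarrow> 'k::field mpoly set \<Rightarrow> 'k mpoly set \<Rightarrow> ('k mpoly set, 'k mpoly set) module" where
  "coord_module n I J =
    restrict_scalars (\<lambda>x. J <+>\<^bsub>poly_ring n\<^esub> x) (self_module (coord_ring n J))"


section \<open>Differential forms of a homogeneous coordinate ring\<close>

definition omega1 ::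
  "nat \<Rightarrow> 'k::field mpoly set
    \<Rightarrow> ('k mpoly set, ('k mpoly set \<Rightarrow> 'k mpoly set) set) module" where
  "omega1 n I = kaehler (coord_ring n I) (range (coord_scalar n I))"

definition omega1_dx ::
  "nat \<Rightarrow> 'k::field mpoly set \<Rightarrow> nat \<Rightarrow> ('k mpoly set \<Rightarrow> 'k mpoly set) set" where
  "omega1_dx n I j =
    kaehler_d (coord_ring n I) (range (coord_scalar n I)) (coord_class n I (poly_var j))"

text \<open>The grading with \<open>deg dx\<^sub>j = 1\<close>: the component of degree \<open>i\<close> is
  \<open>\<Sum>\<^sub>j R\<^sub>i\<^sub>-\<^sub>1 dx\<^sub>j\<close>.\<close>

definition omega1_grade ::
  "nat \<Rightarrow> 'k::field mpoly set \<Rightarrow> int \<Rightarrow> ('k mpoly set \<Rightarrow> 'k mpoly set) set set" where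
  "omega1_grade n I i =
    generate (add_monoid (omega1 n I))
      {r \<odot>\<^bsub>omega1 n I\<^esub> omega1_dx n I j | r j. r \<in> coord_grade n I (i - 1) \<and> j \<le> n}"

definition omega ::
  "nat \<Rightarrow> 'k::field mpoly set \<Rightarrow> nat
    \<Rightarrow> ('k mpoly set, (('k mpoly set \<Rightarrow> 'k mpoly set) set list \<Rightarrow> 'k mpoly set) set) module" where
  "omega n I q = ext_power (coord_ring n I) q (omega1 n I)"

definition omega_grade ::
  "nat \<Rightarrow> 'k::field mpoly set \<Rightarrow> nat \<Rightarrow> int
    \<Rightarrow> (('k mpoly set \<Rightarrow> 'k mpoly set) set list \<Rightarrow> 'k mpoly set) set set" where
  "omega_grade n I q = ext_grade (coord_ring n I) q (omega1 n I) (omega1_grade n I)"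


section \<open>Fat points\<close>

text \<open>
  A point of projective space is given by a vector of homogeneous coordinates, of which only the
  entries of index at most \<open>n\<close> matter.
\<close>

definition same_point :: "nat \<Rightarrow> (nat \<Rightarrow> 'k::field) \<Rightarrow> (nat \<Rightarrow> 'k) \<Rightarrow> bool" where
  "same_point n p q \<longleftrightarrow> (\<exists>c. c \<noteq> 0 \<and> (\<forall>i\<le>n. q i = c * p i))"

definition in_hyperplane :: "nat \<Rightarrow> (nat \<Rightarrow> 'k::field) set \<Rightarrow> bool" where
  "in_hyperplane n X \<longleftrightarrow>
    (\<exists>a. (\<exists>i\<le>n. a i \<noteq> 0) \<and> (\<forall>p\<in>X. (\<Sum>i\<le>n. a i * p i) = 0))"

definition point_ideal :: "nat \<Rightarrow> (nat \<Rightarrow> 'k::field) \<Rightarrow> 'k mpoly set" where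
  "point_ideal n p =
    Idl\<^bsub>poly_ring n\<^esub> {F. (\<exists>d. F \<in> homog_part n d) \<and> poly_eval n p F = 0}"

text \<open>Powers are taken in the multiplicative monoid of ideals, whose unit is the whole ring.\<close>

definition fat_ideal ::
  "nat \<Rightarrow> nat \<Rightarrow> (nat \<Rightarrow> nat \<Rightarrow> 'k::field) \<Rightarrow> (nat \<Rightarrow> nat) \<Rightarrow> 'k mpoly set" where
  "fat_ideal n s P m =
    (\<Inter>j\<in>{1..s}. point_ideal n (P j) [^]\<^bsub>ideals_set (poly_ring n)\<^esub> m j)"

end

(*
  Let S = K[X_0..X_n] and let w = dx_0 ^ ... ^ dx_n. Expanding in the dx_j shows that the top forms
  of R = S/W are the cyclic module R w. The partial derivatives carry W into Y, so they induce
  R-linear forms on the differentials with values in S/Y; the determinant of these forms maps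
  F w to F mod Y, so the annihilator of w lies in Y/W. Conversely, wedging
  0 = dF = sum_j (dF/dX_j) dx_j with the dx_i, i <> k, shows that the partial derivatives of
  every F in W annihilate w. It remains to see that these derivatives generate Y. If l = 0 is a
  hyperplane through the points and k is an index with c = dl/dX_k nonzero, then for G in Y and
  every r the polynomial l^(r+1) D^r G, where D = d/dX_k, lies in W, and its derivative
  l^(r+1) D^(r+1) G + (r+1) c l^r D^r G lets one descend from D^r G = 0 (r large) to G.
*)
theory Submission
  imports Defs "HOL-Combinatorics.Permutations"
begin

section \<open>Modules by generators and relations\<close>

text \<open>In a module given by generators and relations, equations follow from the relations, but
  that an element is nonzero is seen only by mapping out of the module; this is the purpose of the
  determinant. Its values lie in S/Y and not in R because d/dX_j does not descend to R: it costs one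
  order of vanishing at each point, so it is well defined on R only after reduction mod Y. The
  hyperplane serves the opposite inclusion. Its equation l lies in all point ideals at once, so
  l^(r+1) makes up both for the r orders that D^r takes from G and for the one order by which G in Y
  falls short of W; characteristic zero makes (r+1) c invertible. The argument on forms is carried
  out for any pair of ideals W, Y such that W lies in Y and Y is generated by the partial
  derivatives of W (the locale \<open>poly_ideal_pair\<close>). Powers of ideals and points enter
  only afterwards, when fat points are shown to give such a pair.\<close>

lemma (in abelian_group) eq_if_minus_eq_zero:
  "x \<in> carrier G \<Longrightarrow> y \<in> carrier G \<Longrightarrow> x \<ominus> y = \<zero> \<Longrightarrow> x = y"
  using add.inv_solve_right[of \<zero> x y] by (simp add: minus_eq)

context module
begin

lemma submodule_zero: "submodule H R M \<Longrightarrow> \<zero>\<^bsub>M\<^esub> \<in> H"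
  using submodule.axioms(1)[THEN subgroup.one_closed] by fastforce

text \<open>The hypothesis puts \<open>carrier M\<close> into the family that is intersected; over
  the empty family the intersection would be the whole type.\<close>

lemma gen_submodule_submodule:
  assumes "G \<subseteq> carrier M"
  shows "submodule (gen_submodule R M G) R M"
  unfolding gen_submodule_def
  by (rule submoduleI)
    (use assms carrier_is_submodule in
      \<open>auto intro: submodule_zero submoduleE(3) submoduleE(4) submoduleE(5)\<close>)

lemma gen_submodule_incl: "G \<subseteq> gen_submodule R M G"
  by (auto simp: gen_submodule_def)

lemma gen_submodule_minimal:
  "submodule H R M \<Longrightarrow> G \<subseteq> H \<Longrightarrow> gen_submodule R M G \<subseteq> H"
  by (auto simp: gen_submodule_def)

end

lemma (in module) submodule_finsum:
  assumes "submodule H R M" "finite A" "\<And>a. a \<in> A \<Longrightarrow> f a \<in> H"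
  shows "(\<Oplus>\<^bsub>M\<^esub>a\<in>A. f a) \<in> H"
  using assms(2,3)
proof (induction A rule: finite_induct)
  case (insert a A)
  then have "f \<in> A \<rightarrow> carrier M" "f a \<in> carrier M" using submoduleE(1)[OF assms(1)] by auto
  with insert show ?case by (simp add: submoduleE(5)[OF assms(1)])
qed (simp add: submodule_zero[OF assms(1)])

lemma (in module) finsum_smult_delta:
  assumes "i \<in> A" "finite A" "f \<in> A \<rightarrow> carrier M"
  shows "(\<Oplus>\<^bsub>M\<^esub>j\<in>A. (if j = i then \<one> else \<zero>) \<odot>\<^bsub>M\<^esub> f j) = f i"
proof -
  have "(\<Oplus>\<^bsub>M\<^esub>j\<in>A. (if j = i then \<one> else \<zero>) \<odot>\<^bsub>M\<^esub> f j) = (\<Oplus>\<^bsub>M\<^esub>j\<in>A. if i = j then f j else \<zero>\<^bsub>M\<^esub>)"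
    by (rule M.finsum_cong') (use assms in \<open>auto simp: Pi_iff\<close>)
  then show ?thesis using M.finsum_singleton[OF assms] by simp
qed

section \<open>Module homomorphisms and the transport of bases\<close>

definition mod_hom ::
  "('r, 'x) ring_scheme \<Rightarrow> ('r, 'm, 'y) module_scheme \<Rightarrow> ('r, 'n, 'z) module_scheme \<Rightarrow> ('m \<Rightarrow> 'n) set"
  where "mod_hom R M N =
    {h \<in> carrier M \<rightarrow> carrier N.
       (\<forall>x\<in>carrier M. \<forall>y\<in>carrier M. h (x \<oplus>\<^bsub>M\<^esub> y) = h x \<oplus>\<^bsub>N\<^esub> h y)
     \<and> (\<forall>r\<in>carrier R. \<forall>x\<in>carrier M. h (r \<odot>\<^bsub>M\<^esub> x) = r \<odot>\<^bsub>N\<^esub> h x)}"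

lemma mod_homI:
  assumes "\<And>x. x \<in> carrier M \<Longrightarrow> h x \<in> carrier N"
    and "\<And>x y. x \<in> carrier M \<Longrightarrow> y \<in> carrier M \<Longrightarrow> h (x \<oplus>\<^bsub>M\<^esub> y) = h x \<oplus>\<^bsub>N\<^esub> h y"
    and "\<And>r x. r \<in> carrier R \<Longrightarrow> x \<in> carrier M \<Longrightarrow> h (r \<odot>\<^bsub>M\<^esub> x) = r \<odot>\<^bsub>N\<^esub> h x"
  shows "h \<in> mod_hom R M N"
  using assms by (auto simp: mod_hom_def)

locale module_hom = M: module R M + N: module R N
  for R (structure) and M :: "('r, 'm, 'y) module_scheme" and N :: "('r, 'n, 'z) module_scheme" +
  fixes h
  assumes hom: "h \<in> mod_hom R M N"
begin

lemma closed [simp, intro]: "x \<in> carrier M \<Longrightarrow> h x \<in> carrier N"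
  using hom by (auto simp: mod_hom_def)

lemma add: "x \<in> carrier M \<Longrightarrow> y \<in> carrier M \<Longrightarrow> h (x \<oplus>\<^bsub>M\<^esub> y) = h x \<oplus>\<^bsub>N\<^esub> h y"
  using hom by (auto simp: mod_hom_def)

lemma smult: "r \<in> carrier R \<Longrightarrow> x \<in> carrier M \<Longrightarrow> h (r \<odot>\<^bsub>M\<^esub> x) = r \<odot>\<^bsub>N\<^esub> h x"
  using hom by (auto simp: mod_hom_def)

sublocale abelian_group_hom M N h
  by (rule abelian_group_homI)
    (auto simp: M.abelian_group_axioms N.abelian_group_axioms group_hom_def group_hom_axioms_def
      hom_def add M.a_group N.a_group)

lemma minus: "x \<in> carrier M \<Longrightarrow> y \<in> carrier M \<Longrightarrow> h (x \<ominus>\<^bsub>M\<^esub> y) = h x \<ominus>\<^bsub>N\<^esub> h y"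
  by (simp add: a_minus_def)

lemma finsum:
  assumes "finite A" "f \<in> A \<rightarrow> carrier M"
  shows "h (\<Oplus>\<^bsub>M\<^esub>a\<in>A. f a) = (\<Oplus>\<^bsub>N\<^esub>a\<in>A. h (f a))"
  using assms
proof (induction A)
  case (insert a A)
  then have "h (\<Oplus>\<^bsub>M\<^esub>a\<in>A. f a) = (\<Oplus>\<^bsub>N\<^esub>a\<in>A. h (f a))" "f a \<in> carrier M" "f \<in> A \<rightarrow> carrier M"
    by auto
  with insert.hyps show ?case
    by (subst M.finsum_insert, auto simp: Pi_def)
qed simp

text \<open>The elements that h sends into H form a submodule, so such a claim has to be checked on
  generators only. The generation arguments below rest on this.\<close>

lemma vimage_submodule:
  assumes "submodule H R N"
  shows "submodule {x \<in> carrier M. h x \<in> H} R M"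
  using N.submoduleE[OF assms] N.submodule_zero[OF assms]
  by (intro M.submoduleI) (auto simp: smult)

text \<open>With \<open>gen_submodule_minimal\<close>: a homomorphism that kills the relations kills
  the submodule generated by them, and so factors through the quotient.\<close>

lemma kernel_submodule: "submodule {x \<in> carrier M. h x = \<zero>\<^bsub>N\<^esub>} R M"
  by (intro M.submoduleI) (auto simp: smult)

end

lemma module_homI:
  assumes "module R M" "module R N" "h \<in> mod_hom R M N"
  shows "module_hom R M N h"
  using assms by (auto simp: module_hom_def module_hom_axioms_def)

context module_hom
begin

text \<open>The homogeneous components of modules of forms are additive groups spanned by explicit
  elements, in general not submodules. Degrees are therefore compared on generators of
  groups.\<close>

lemma generate_image:
  assumes "U \<subseteq> carrier M" "subgroup H (add_monoid N)" "h ` U \<subseteq> H"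
  shows "h ` generate (add_monoid M) U \<subseteq> H"
proof -
  have "subgroup {x \<in> carrier M. h x \<in> H} (add_monoid M)"
    using subgroup.m_closed[OF assms(2)] subgroup.m_inv_closed[OF assms(2)] subgroup.one_closed[OF assms(2)]
    by (intro M.add.subgroupI) (auto simp: add a_inv_def[symmetric])
  then have "generate (add_monoid M) U \<subseteq> {x \<in> carrier M. h x \<in> H}"
    using assms by (intro M.add.generate_subgroup_incl) auto
  then show ?thesis by blast
qed

text \<open>Coefficients on the image of B are pulled back along h and cut down to B, because
  coefficient functions are extensional. Injectivity on the whole carrier turns an equation between
  images into an equation in M, which gives uniqueness.\<close>

lemma is_finite_basis_image:
  assumes inj: "inj_on h (carrier M)" and V: "V \<subseteq> carrier M" and sc: "range sc \<subseteq> carrier R"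
    and basis: "is_finite_basis sc M V B"
  shows "is_finite_basis sc N (h ` V) (h ` B)"
proof -
  have B: "finite B" "B \<subseteq> V" "B \<subseteq> carrier M" using basis V by (auto simp: is_finite_basis_def)
  have injB: "inj_on h B" using inj B by (meson inj_on_subset)
  let ?S = "\<lambda>c. \<Oplus>\<^bsub>M\<^esub>b\<in>B. sc (c b) \<odot>\<^bsub>M\<^esub> b"
  have sc_closed: "sc a \<in> carrier R" for a using sc by auto
  have term_closed: "sc a \<odot>\<^bsub>M\<^esub> b \<in> carrier M" if "b \<in> B" for a b
    using that sc B by auto
  have sum: "(\<Oplus>\<^bsub>N\<^esub>y\<in>h ` B. sc (c y) \<odot>\<^bsub>N\<^esub> y) = h (?S (\<lambda>b\<in>B. c (h b)))" for c
  proof -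
    have "(\<Oplus>\<^bsub>N\<^esub>y\<in>h ` B. sc (c y) \<odot>\<^bsub>N\<^esub> y) = (\<Oplus>\<^bsub>N\<^esub>b\<in>B. sc (c (h b)) \<odot>\<^bsub>N\<^esub> h b)"
      by (rule N.finsum_reindex[OF _ injB]) (use B sc_closed in auto)
    also have "\<dots> = (\<Oplus>\<^bsub>N\<^esub>b\<in>B. h (sc ((\<lambda>b\<in>B. c (h b)) b) \<odot>\<^bsub>M\<^esub> b))"
      by (rule N.finsum_cong') (use B sc_closed term_closed in \<open>auto simp: smult\<close>)
    also have "\<dots> = h (?S (\<lambda>b\<in>B. c (h b)))"
      by (rule finsum[symmetric]) (use B term_closed in auto)
    finally show ?thesis .
  qed
  have eq_iff: "h v = (\<Oplus>\<^bsub>N\<^esub>y\<in>h ` B. sc (c y) \<odot>\<^bsub>N\<^esub> y) \<longleftrightarrow> v = ?S (\<lambda>b\<in>B. c (h b))" if "v \<in> V" for v c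
  proof -
    have "?S (\<lambda>b\<in>B. c (h b)) \<in> carrier M" by (rule M.finsum_closed) (use term_closed in auto)
    then show ?thesis using that V inj unfolding sum by (auto simp: inj_on_eq_iff)
  qed
  have "\<exists>!c. c \<in> h ` B \<rightarrow>\<^sub>E UNIV \<and> h v = (\<Oplus>\<^bsub>N\<^esub>y\<in>h ` B. sc (c y) \<odot>\<^bsub>N\<^esub> y)" if v: "v \<in> V" for v
  proof (rule ex_ex1I)
    from basis v obtain c where c: "c \<in> B \<rightarrow>\<^sub>E UNIV" "v = ?S c"
      by (auto simp: is_finite_basis_def)
    define c' where "c' = (\<lambda>y\<in>h ` B. c (inv_into B h y))"
    have "(\<lambda>b\<in>B. c' (h b)) = c"
      using c(1) injB by (auto simp: c'_def PiE_iff extensional_def fun_eq_iff)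
    then have "h v = (\<Oplus>\<^bsub>N\<^esub>y\<in>h ` B. sc (c' y) \<odot>\<^bsub>N\<^esub> y)" using eq_iff[OF v, of c'] c(2) by simp
    moreover have "c' \<in> h ` B \<rightarrow>\<^sub>E UNIV" by (auto simp: c'_def)
    ultimately show "\<exists>c. c \<in> h ` B \<rightarrow>\<^sub>E UNIV \<and> h v = (\<Oplus>\<^bsub>N\<^esub>y\<in>h ` B. sc (c y) \<odot>\<^bsub>N\<^esub> y)" by blast
  next
    fix c c' assume c: "c \<in> h ` B \<rightarrow>\<^sub>E UNIV \<and> h v = (\<Oplus>\<^bsub>N\<^esub>y\<in>h ` B. sc (c y) \<odot>\<^bsub>N\<^esub> y)"
      and c': "c' \<in> h ` B \<rightarrow>\<^sub>E UNIV \<and> h v = (\<Oplus>\<^bsub>N\<^esub>y\<in>h ` B. sc (c' y) \<odot>\<^bsub>N\<^esub> y)"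
    have ex1: "\<exists>!c. c \<in> B \<rightarrow>\<^sub>E UNIV \<and> v = ?S c" using basis v by (auto simp: is_finite_basis_def)
    then obtain c0 where uniq: "\<And>c. c \<in> B \<rightarrow>\<^sub>E UNIV \<and> v = ?S c \<Longrightarrow> c = c0"
      by (elim ex1E) blast
    have "v = ?S (\<lambda>b\<in>B. c (h b))" "v = ?S (\<lambda>b\<in>B. c' (h b))"
      using c c' eq_iff[OF v] by blast+
    moreover have "(\<lambda>b\<in>B. c (h b)) \<in> B \<rightarrow>\<^sub>E UNIV" "(\<lambda>b\<in>B. c' (h b)) \<in> B \<rightarrow>\<^sub>E UNIV"
      by simp_all
    ultimately have "(\<lambda>b\<in>B. c (h b)) = (\<lambda>b\<in>B. c' (h b))"
      by (intro trans[OF uniq uniq[symmetric]] conjI)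
    then have "c (h b) = c' (h b)" if "b \<in> B" for b using that by (metis restrict_apply')
    then show "c = c'" using c c' by (intro PiE_ext[of c "h ` B" "\<lambda>_. UNIV"]) auto
  qed
  then show ?thesis using B by (auto simp: is_finite_basis_def)
qed

lemma inverse_hom:
  assumes "bij_betw h (carrier M) (carrier N)"
  shows "inv_into (carrier M) h \<in> mod_hom R N M"
proof (rule mod_homI)
  note inv = bij_betw_inv_into_left[OF assms] bij_betw_inv_into_right[OF assms]
  show closed: "inv_into (carrier M) h y \<in> carrier M" if "y \<in> carrier N" for y
    using that assms by (metis bij_betw_def inv_into_into)
  show "inv_into (carrier M) h (x \<oplus>\<^bsub>N\<^esub> y) = inv_into (carrier M) h x \<oplus>\<^bsub>M\<^esub> inv_into (carrier M) h y"
    if "x \<in> carrier N" "y \<in> carrier N" for x y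
    using inv(1)[of "inv_into (carrier M) h x \<oplus>\<^bsub>M\<^esub> inv_into (carrier M) h y"] that
    by (simp add: add closed inv)
  show "inv_into (carrier M) h (r \<odot>\<^bsub>N\<^esub> y) = r \<odot>\<^bsub>M\<^esub> inv_into (carrier M) h y"
    if "r \<in> carrier R" "y \<in> carrier N" for r y
    using inv(1)[of "r \<odot>\<^bsub>M\<^esub> inv_into (carrier M) h y"] that by (simp add: smult closed inv)
qed

text \<open>\<open>vdim\<close> is a definite description over the cardinalities of bases. Bases are
  carried in both directions, so the two descriptions have the same predicate; the equality thus
  holds also where no finite basis exists.\<close>

lemma vdim_image:
  assumes bij: "bij_betw h (carrier M) (carrier N)" and V: "V \<subseteq> carrier M" and sc: "range sc \<subseteq> carrier R"
  shows "vdim sc N (h ` V) = vdim sc M V"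
proof -
  let ?g = "inv_into (carrier M) h"
  interpret g: module_hom R N M ?g
    by (intro module_homI N.module_axioms M.module_axioms inverse_hom bij)
  have inj: "inj_on h (carrier M)" using bij by (simp add: bij_betw_def)
  have injg: "inj_on ?g (carrier N)" using bij by (metis bij_betw_def inj_on_inv_into order_refl)
  have gV: "?g ` h ` V = V" using V inj by (simp add: inv_into_image_cancel)
  have "(\<exists>B. is_finite_basis sc N (h ` V) B \<and> card B = k) \<longleftrightarrow> (\<exists>B. is_finite_basis sc M V B \<and> card B = k)" for k
  proof
    assume "\<exists>B. is_finite_basis sc N (h ` V) B \<and> card B = k"
    then obtain B where B: "is_finite_basis sc N (h ` V) B" "card B = k" by blast
    then have "is_finite_basis sc M V (?g ` B)"
      using g.is_finite_basis_image[OF injg _ sc, of "h ` V" B] V gV by auto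
    moreover have "B \<subseteq> h ` V" using B(1) by (simp add: is_finite_basis_def)
    then have "B \<subseteq> carrier N" by (rule subset_trans) (use V in auto)
    then have "card (?g ` B) = k" using B(2) card_image[OF inj_on_subset[OF injg]] by simp
    ultimately show "\<exists>B. is_finite_basis sc M V B \<and> card B = k" by blast
  next
    assume "\<exists>B. is_finite_basis sc M V B \<and> card B = k"
    then obtain B where B: "is_finite_basis sc M V B" "card B = k" by blast
    then have "is_finite_basis sc N (h ` V) (h ` B)" using is_finite_basis_image[OF inj V sc] by simp
    moreover have "B \<subseteq> carrier M" using B(1) V by (auto simp: is_finite_basis_def)
    then have "card (h ` B) = k" using B(2) card_image[OF inj_on_subset[OF inj]] by simp
    ultimately show "\<exists>B. is_finite_basis sc N (h ` V) B \<and> card B = k" by blast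
  qed
  then show ?thesis by (simp add: vdim_def)
qed

end

section \<open>Free modules and their universal property\<close>

lemma (in cring) free_module_module: "module R (free_module R B)" (is "module R ?F")
proof (rule moduleI)
  \<comment> \<open>All operations act entrywise and vanish where their arguments do, so the support
    of the result lies in the union of two finite supports. Unary operations use the same argument
    twice.\<close>
  have carrierI: "(\<lambda>b\<in>B. h b) \<in> carrier ?F"
    if "f \<in> carrier ?F" "g \<in> carrier ?F" "\<And>b. b \<in> B \<Longrightarrow> h b \<in> carrier R"
      "\<And>b. b \<in> B \<Longrightarrow> f b = \<zero> \<Longrightarrow> g b = \<zero> \<Longrightarrow> h b = \<zero>" for f g h
  proof -
    have "finite {b \<in> B. h b \<noteq> \<zero>}"
      by (rule finite_subset[of _ "{b \<in> B. f b \<noteq> \<zero>} \<union> {b \<in> B. g b \<noteq> \<zero>}"])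
        (use that in \<open>auto simp: free_module_def\<close>)
    moreover have "{b \<in> B. (\<lambda>b\<in>B. h b) b \<noteq> \<zero>} = {b \<in> B. h b \<noteq> \<zero>}" by auto
    ultimately show ?thesis using that(3) by (simp add: free_module_def)
  qed
  have closed: "f b \<in> carrier R" if "f \<in> carrier ?F" "b \<in> B" for f b
    using that by (auto simp: free_module_def)
  have ext: "f = g" if "f \<in> carrier ?F" "g \<in> carrier ?F" "\<And>b. b \<in> B \<Longrightarrow> f b = g b" for f g
    using that by (auto simp: free_module_def intro: PiE_ext)
  have add: "f \<oplus>\<^bsub>?F\<^esub> g = (\<lambda>b\<in>B. f b \<oplus> g b)" and smult: "r \<odot>\<^bsub>?F\<^esub> f = (\<lambda>b\<in>B. r \<otimes> f b)"
    and zero: "\<zero>\<^bsub>?F\<^esub> = (\<lambda>b\<in>B. \<zero>)" for r f g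
    by (auto simp: free_module_def)
  have add_closed: "f \<oplus>\<^bsub>?F\<^esub> g \<in> carrier ?F" if "f \<in> carrier ?F" "g \<in> carrier ?F" for f g
    unfolding add by (rule carrierI[OF that]) (use that closed in auto)
  have zero_closed: "\<zero>\<^bsub>?F\<^esub> \<in> carrier ?F"
    by (simp add: free_module_def)
  have smult_closed: "r \<odot>\<^bsub>?F\<^esub> f \<in> carrier ?F" if "r \<in> carrier R" "f \<in> carrier ?F" for r f
    unfolding smult by (rule carrierI[OF that(2,2)]) (use that closed in auto)
  show "abelian_group ?F"
  proof (rule abelian_groupI)
    fix f assume f: "f \<in> carrier ?F"
    have neg: "(\<lambda>b\<in>B. \<ominus> f b) \<in> carrier ?F"
      by (rule carrierI[OF f f]) (use f closed in auto)
    moreover have "(\<lambda>b\<in>B. \<ominus> f b) \<oplus>\<^bsub>?F\<^esub> f = \<zero>\<^bsub>?F\<^esub>"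
      by (rule ext[OF add_closed[OF neg f] zero_closed])
        (use f closed in \<open>auto simp: add zero l_neg\<close>)
    ultimately show "\<exists>g\<in>carrier ?F. g \<oplus>\<^bsub>?F\<^esub> f = \<zero>\<^bsub>?F\<^esub>" by blast
    show "\<zero>\<^bsub>?F\<^esub> \<oplus>\<^bsub>?F\<^esub> f = f"
      by (rule ext[OF add_closed[OF zero_closed f] f]) (use f closed in \<open>auto simp: add zero\<close>)
    fix g assume g: "g \<in> carrier ?F"
    show "f \<oplus>\<^bsub>?F\<^esub> g = g \<oplus>\<^bsub>?F\<^esub> f"
      by (rule ext[OF add_closed[OF f g] add_closed[OF g f]])
        (use f g in \<open>auto simp: add a_comm closed\<close>)
    fix h assume h: "h \<in> carrier ?F"
    show "f \<oplus>\<^bsub>?F\<^esub> g \<oplus>\<^bsub>?F\<^esub> h = f \<oplus>\<^bsub>?F\<^esub> (g \<oplus>\<^bsub>?F\<^esub> h)"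
      by (rule ext[OF add_closed[OF add_closed[OF f g] h] add_closed[OF f add_closed[OF g h]]])
        (use f g h in \<open>auto simp: add a_assoc closed\<close>)
  qed (auto simp: add_closed zero_closed)
  fix r f assume rf: "r \<in> carrier R" "f \<in> carrier ?F"
  then show "r \<odot>\<^bsub>?F\<^esub> f \<in> carrier ?F" by (rule smult_closed)
  fix g assume g: "g \<in> carrier ?F"
  show "r \<odot>\<^bsub>?F\<^esub> (f \<oplus>\<^bsub>?F\<^esub> g) = r \<odot>\<^bsub>?F\<^esub> f \<oplus>\<^bsub>?F\<^esub> r \<odot>\<^bsub>?F\<^esub> g"
    by (rule ext[OF smult_closed[OF rf(1) add_closed[OF rf(2) g]]
          add_closed[OF smult_closed[OF rf] smult_closed[OF rf(1) g]]])
      (use rf g in \<open>auto simp: smult add r_distr closed\<close>)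
next
  fix r q f assume "r \<in> carrier R" "q \<in> carrier R" "f \<in> carrier ?F"
  then show "(r \<oplus> q) \<odot>\<^bsub>?F\<^esub> f = r \<odot>\<^bsub>?F\<^esub> f \<oplus>\<^bsub>?F\<^esub> q \<odot>\<^bsub>?F\<^esub> f"
    and "(r \<otimes> q) \<odot>\<^bsub>?F\<^esub> f = r \<odot>\<^bsub>?F\<^esub> (q \<odot>\<^bsub>?F\<^esub> f)"
    by (auto simp: free_module_def l_distr m_assoc PiE_iff intro!: restrict_ext)
next
  fix f assume "f \<in> carrier ?F"
  then show "\<one> \<odot>\<^bsub>?F\<^esub> f = f"
    by (auto simp: free_module_def PiE_iff extensional_def)
qed (rule cring_axioms)

context cring
begin

lemma free_gen_closed: "b \<in> B \<Longrightarrow> free_gen R B b \<in> carrier (free_module R B)"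
  by (auto simp: free_module_def free_gen_def PiE_iff)

text \<open>Induction on the finite support, splitting off a multiple of one generator at a
  time.\<close>

lemma free_module_generated:
  assumes "submodule H R (free_module R B)" and "\<And>b. b \<in> B \<Longrightarrow> free_gen R B b \<in> H"
  shows "carrier (free_module R B) \<subseteq> H"
proof
  interpret F: module R "free_module R B" by (rule free_module_module)
  note H = F.submoduleE[OF assms(1)] F.submodule_zero[OF assms(1)]
  fix f assume "f \<in> carrier (free_module R B)"
  moreover define A where "A = {b \<in> B. f b \<noteq> \<zero>}"
  ultimately have "finite A" by (auto simp: free_module_def)
  then show "f \<in> H" using \<open>f \<in> carrier (free_module R B)\<close> A_def
  proof (induction A arbitrary: f)
    case empty
    then have "f = \<zero>\<^bsub>free_module R B\<^esub>"
      by (auto simp: free_module_def PiE_iff extensional_def)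
    then show ?case using H(7) by simp
  next
    case (insert a A)
    define g where "g = (\<lambda>b\<in>B. if b = a then \<zero> else f b)"
    have a: "a \<in> B" "f a \<in> carrier R"
      using insert.prems insert.hyps by (auto simp: free_module_def)
    have fin: "finite {b \<in> B. g b \<noteq> \<zero>}"
      by (rule finite_subset[of _ "{b \<in> B. f b \<noteq> \<zero>}"]) (use insert.prems in \<open>auto simp: g_def free_module_def\<close>)
    have "g \<in> carrier (free_module R B)"
      using insert.prems fin by (auto simp: free_module_def PiE_iff g_def)
    moreover have "A = {b \<in> B. g b \<noteq> \<zero>}"
      using insert.prems(2) insert.hyps by (auto simp: g_def)
    ultimately have "g \<in> H" by (rule insert.IH)
    moreover have "f = g \<oplus>\<^bsub>free_module R B\<^esub> f a \<odot>\<^bsub>free_module R B\<^esub> free_gen R B a"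
      using insert.prems a
      by (auto simp: free_module_def PiE_iff g_def free_gen_def extensional_def intro!: ext)
    ultimately show ?case using H(4,5) assms(2)[OF a(1)] a by metis
  qed
qed

lemma free_module_lift:
  assumes "module R N" and \<phi>: "\<And>b. b \<in> B \<Longrightarrow> \<phi> b \<in> carrier N"
  obtains h where "h \<in> mod_hom R (free_module R B) N"
    and "\<And>b. b \<in> B \<Longrightarrow> h (free_gen R B b) = \<phi> b"
proof
  interpret N: module R N by fact
  define h where "h f = (\<Oplus>\<^bsub>N\<^esub>b\<in>{b \<in> B. f b \<noteq> \<zero>}. f b \<odot>\<^bsub>N\<^esub> \<phi> b)" for f
  \<comment> \<open>The sum may run over any finite set that contains the support. This is needed
    for additivity, where the union of the supports of f and g serves f, g and their sum
    alike.\<close>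
  have h: "h f = (\<Oplus>\<^bsub>N\<^esub>b\<in>A. f b \<odot>\<^bsub>N\<^esub> \<phi> b)"
    if "finite A" "A \<subseteq> B" "{b \<in> B. f b \<noteq> \<zero>} \<subseteq> A" "f \<in> B \<rightarrow> carrier R" for f A
    unfolding h_def
    by (rule N.add.finprod_mono_neutral_cong_left) (use that \<phi> in \<open>auto 0 3 simp: Pi_iff\<close>)
  show "h \<in> mod_hom R (free_module R B) N"
  proof (rule mod_homI)
    fix f assume f: "f \<in> carrier (free_module R B)"
    then show "h f \<in> carrier N"
      unfolding h_def by (intro N.finsum_closed) (auto simp: free_module_def \<phi> PiE_iff)
    fix r assume r: "r \<in> carrier R"
    let ?A = "{b \<in> B. f b \<noteq> \<zero>}"
    have fin: "finite ?A" using f by (auto simp: free_module_def)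
    have rf: "r \<odot>\<^bsub>free_module R B\<^esub> f = (\<lambda>b\<in>B. r \<otimes> f b)" by (auto simp: free_module_def)
    have "h (r \<odot>\<^bsub>free_module R B\<^esub> f) = (\<Oplus>\<^bsub>N\<^esub>b\<in>?A. (r \<otimes> f b) \<odot>\<^bsub>N\<^esub> \<phi> b)"
      unfolding rf by (subst h[of ?A]) (use f r fin \<phi> in \<open>auto simp: free_module_def PiE_iff intro!: N.finsum_cong'\<close>)
    also have "\<dots> = (\<Oplus>\<^bsub>N\<^esub>b\<in>?A. r \<odot>\<^bsub>N\<^esub> (f b \<odot>\<^bsub>N\<^esub> \<phi> b))"
      by (rule N.finsum_cong') (use f r \<phi> in \<open>auto simp: free_module_def PiE_iff N.smult_assoc1\<close>)
    also have "\<dots> = r \<odot>\<^bsub>N\<^esub> h f"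
      unfolding h_def by (rule N.finsum_smult_ldistr[symmetric])
        (use f r \<phi> fin in \<open>auto simp: free_module_def PiE_iff\<close>)
    finally show "h (r \<odot>\<^bsub>free_module R B\<^esub> f) = r \<odot>\<^bsub>N\<^esub> h f" .
  next
    fix f g assume fg: "f \<in> carrier (free_module R B)" "g \<in> carrier (free_module R B)"
    let ?A = "{b \<in> B. f b \<noteq> \<zero>} \<union> {b \<in> B. g b \<noteq> \<zero>}"
    have fin: "finite ?A" using fg by (auto simp: free_module_def)
    have f: "f \<in> B \<rightarrow> carrier R" and g: "g \<in> B \<rightarrow> carrier R"
      using fg by (auto simp: free_module_def)
    have sum: "f \<oplus>\<^bsub>free_module R B\<^esub> g = (\<lambda>b\<in>B. f b \<oplus> g b)" by (auto simp: free_module_def)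
    have "h (f \<oplus>\<^bsub>free_module R B\<^esub> g) = (\<Oplus>\<^bsub>N\<^esub>b\<in>?A. (f b \<oplus> g b) \<odot>\<^bsub>N\<^esub> \<phi> b)"
      unfolding sum by (subst h[of ?A]) (use f g fin \<phi> in \<open>auto simp: Pi_iff intro!: N.finsum_cong'\<close>)
    also have "\<dots> = (\<Oplus>\<^bsub>N\<^esub>b\<in>?A. f b \<odot>\<^bsub>N\<^esub> \<phi> b \<oplus>\<^bsub>N\<^esub> g b \<odot>\<^bsub>N\<^esub> \<phi> b)"
      by (rule N.finsum_cong') (use f g \<phi> in \<open>auto simp: Pi_iff N.smult_l_distr\<close>)
    also have "\<dots> = (\<Oplus>\<^bsub>N\<^esub>b\<in>?A. f b \<odot>\<^bsub>N\<^esub> \<phi> b) \<oplus>\<^bsub>N\<^esub> (\<Oplus>\<^bsub>N\<^esub>b\<in>?A. g b \<odot>\<^bsub>N\<^esub> \<phi> b)"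
      by (rule N.finsum_addf) (use f g \<phi> in \<open>auto simp: Pi_iff\<close>)
    also have "\<dots> = h f \<oplus>\<^bsub>N\<^esub> h g"
      using h[of ?A f] h[of ?A g] fin f g by auto
    finally show "h (f \<oplus>\<^bsub>free_module R B\<^esub> g) = h f \<oplus>\<^bsub>N\<^esub> h g" .
  qed
  fix b assume b: "b \<in> B"
  have "h (free_gen R B b) = (\<Oplus>\<^bsub>N\<^esub>a\<in>{b}. free_gen R B b a \<odot>\<^bsub>N\<^esub> \<phi> a)"
    by (rule h) (use b in \<open>auto simp: free_gen_def\<close>)
  also have "\<dots> = free_gen R B b b \<odot>\<^bsub>N\<^esub> \<phi> b"
    by (subst N.finsum_insert) (use b \<phi> in \<open>auto simp: free_gen_def\<close>)
  finally show "h (free_gen R B b) = \<phi> b" using b \<phi> by (simp add: free_gen_def)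
qed

end

section \<open>Quotient modules\<close>

locale quotient_module = M: module R M for R (structure) and M :: "('r, 'm, 'y) module_scheme" +
  fixes N
  assumes submodule: "submodule N R M"
begin

sublocale N: abelian_subgroup N M
  using submodule.axioms(1)[OF submodule]
  by (intro abelian_subgroupI3 additive_subgroup.intro M.abelian_group_axioms)

abbreviation "Q \<equiv> quot_module M N"
abbreviation "\<pi> x \<equiv> N +>\<^bsub>M\<^esub> x"

lemma carrier_Q: "carrier Q = \<pi> ` carrier M"
  by (auto simp: quot_module_def A_RCOSETS_def' a_r_coset_def')

lemma proj_eq_iff:
  assumes "x \<in> carrier M" "y \<in> carrier M"
  shows "\<pi> x = \<pi> y \<longleftrightarrow> x \<ominus>\<^bsub>M\<^esub> y \<in> N"
proof -
  have "x \<ominus>\<^bsub>M\<^esub> y \<in> N \<longleftrightarrow> x \<in> \<pi> y"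
    using N.a_rcos_module[of y x] assms by (simp add: a_minus_def)
  then show ?thesis
    using assms N.a_repr_independence'[of x y] N.a_rcos_self[of x] by auto
qed

lemma proj_add: "x \<in> carrier M \<Longrightarrow> y \<in> carrier M \<Longrightarrow> \<pi> (x \<oplus>\<^bsub>M\<^esub> y) = \<pi> x \<oplus>\<^bsub>Q\<^esub> \<pi> y"
  by (simp add: quot_module_def N.a_rcos_sum)

lemma proj_zero: "\<pi> \<zero>\<^bsub>M\<^esub> = \<zero>\<^bsub>Q\<^esub>"
  by (simp add: quot_module_def N.a_subset)

lemma proj_eq_zero_iff: "x \<in> carrier M \<Longrightarrow> \<pi> x = \<zero>\<^bsub>Q\<^esub> \<longleftrightarrow> x \<in> N"
  using N.a_rcos_const[of x] N.a_rcos_self[of x] by (auto simp: quot_module_def)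

text \<open>The scalar multiple of a coset is a union over its elements y. All of them contribute
  the same coset, since r (y - x) stays in N.\<close>

lemma proj_smult:
  assumes "r \<in> carrier R" "x \<in> carrier M"
  shows "\<pi> (r \<odot>\<^bsub>M\<^esub> x) = r \<odot>\<^bsub>Q\<^esub> \<pi> x"
proof -
  have eq: "\<pi> (r \<odot>\<^bsub>M\<^esub> y) = \<pi> (r \<odot>\<^bsub>M\<^esub> x)" if "y \<in> \<pi> x" for y
  proof -
    have y: "y \<in> carrier M" using N.a_elemrcos_carrier that assms by blast
    have "\<pi> y = \<pi> x" using N.a_repr_independence'[OF that] assms by simp
    then have "r \<odot>\<^bsub>M\<^esub> (y \<ominus>\<^bsub>M\<^esub> x) \<in> N"
      using y assms proj_eq_iff submodule.smult_closed[OF submodule] by blast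
    then show ?thesis using y assms
      by (simp add: proj_eq_iff a_minus_def M.smult_r_distr M.smult_r_minus)
  qed
  have "r \<odot>\<^bsub>Q\<^esub> \<pi> x = (\<Union>y\<in>\<pi> x. \<pi> (r \<odot>\<^bsub>M\<^esub> y))" by (simp add: quot_module_def)
  also have "\<dots> = (\<Union>y\<in>\<pi> x. \<pi> (r \<odot>\<^bsub>M\<^esub> x))" by (rule SUP_cong[OF refl eq])
  also have "\<dots> = \<pi> (r \<odot>\<^bsub>M\<^esub> x)" using N.a_rcos_self[OF assms(2)] by blast
  finally show ?thesis by simp
qed

lemma module_Q: "module R Q"
proof (rule moduleI)
  show "abelian_group Q"
  proof (rule abelian_groupI)
    fix X assume "X \<in> carrier Q"
    then obtain x where "x \<in> carrier M" "X = \<pi> x" by (auto simp: carrier_Q)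
    then show "\<exists>Y\<in>carrier Q. Y \<oplus>\<^bsub>Q\<^esub> X = \<zero>\<^bsub>Q\<^esub>"
      by (intro bexI[of _ "\<pi> (\<ominus>\<^bsub>M\<^esub> x)"]) (auto simp: carrier_Q M.l_neg proj_zero simp flip: proj_add)
  next
    fix X assume "X \<in> carrier Q"
    then show "\<zero>\<^bsub>Q\<^esub> \<oplus>\<^bsub>Q\<^esub> X = X"
      using proj_add[of "\<zero>\<^bsub>M\<^esub>"] by (auto simp: carrier_Q proj_zero)
  next
    show "\<zero>\<^bsub>Q\<^esub> \<in> carrier Q"
      using M.zero_closed by (auto simp: carrier_Q simp flip: proj_zero)
  qed (auto simp: carrier_Q M.a_ac simp flip: proj_add)
  show "cring R" ..
qed (auto simp: carrier_Q M.smult_l_distr M.smult_r_distr M.smult_assoc1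
    simp flip: proj_add proj_smult)

lemma proj_hom: "\<pi> \<in> mod_hom R M Q"
  by (rule mod_homI) (auto simp: carrier_Q proj_add proj_smult)

sublocale proj: module_hom R M Q \<pi>
  using module_homI[OF M.module_axioms module_Q proj_hom] .

text \<open>The map g evaluates h at a chosen representative; h vanishes on N, so the choice does
  not matter.\<close>

lemma lift:
  assumes "module R P" "h \<in> mod_hom R M P" "\<And>x. x \<in> N \<Longrightarrow> h x = \<zero>\<^bsub>P\<^esub>"
  obtains g where "g \<in> mod_hom R Q P" "\<And>x. x \<in> carrier M \<Longrightarrow> g (\<pi> x) = h x"
proof
  interpret P: module R P by fact
  interpret h: module_hom R M P h using assms M.module_axioms by (intro module_homI)
  define g where "g X = h (SOME x. x \<in> carrier M \<and> X = \<pi> x)" for X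
  show g: "g (\<pi> x) = h x" if "x \<in> carrier M" for x
  proof -
    define y where "y = (SOME y. y \<in> carrier M \<and> \<pi> x = \<pi> y)"
    have y: "y \<in> carrier M" "\<pi> x = \<pi> y"
      using someI[of "\<lambda>y. y \<in> carrier M \<and> \<pi> x = \<pi> y" x] that by (auto simp: y_def)
    then have "h (x \<ominus>\<^bsub>M\<^esub> y) = \<zero>\<^bsub>P\<^esub>" using assms(3) proj_eq_iff that by simp
    then have "h x = h y"
      using y that P.eq_if_minus_eq_zero[of "h x" "h y"] by (simp add: h.minus)
    then show ?thesis by (simp add: g_def y_def)
  qed
  show "g \<in> mod_hom R Q P"
    by (rule mod_homI) (auto simp: carrier_Q g h.add h.smult simp flip: proj_add proj_smult)
qed

text \<open>That G generates M is put in the form: a submodule containing G is everything. It is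
  applied to the preimage of H.\<close>

lemma generated:
  assumes "submodule H R Q" "\<And>K. submodule K R M \<Longrightarrow> G \<subseteq> K \<Longrightarrow> carrier M \<subseteq> K"
    and "G \<subseteq> carrier M" "\<pi> ` G \<subseteq> H"
  shows "carrier Q \<subseteq> H"
proof -
  have "carrier M \<subseteq> {x \<in> carrier M. \<pi> x \<in> H}"
    by (rule assms(2)[OF proj.vimage_submodule[OF assms(1)]]) (use assms(3,4) in blast)
  then show ?thesis unfolding carrier_Q by blast
qed

end

section \<open>Kaehler differentials and exterior powers\<close>

locale kaehler_module = cring R for R (structure) +
  fixes A
  assumes constants: "A \<subseteq> carrier R"
begin

abbreviation "F \<equiv> free_module R (carrier R)"
abbreviation "\<Omega> \<equiv> kaehler R A"
abbreviation "d \<equiv> kaehler_d R A"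

sublocale F: module R F by (rule free_module_module)

lemma relations_closed: "kaehler_relations R A \<subseteq> carrier F"
  using constants by (auto simp: kaehler_relations_def Let_def free_gen_closed)

sublocale quotient_module R F "kaehler_submodule R A"
  by (intro quotient_module.intro F.module_axioms quotient_module_axioms.intro)
    (simp add: kaehler_submodule_def F.gen_submodule_submodule relations_closed)

lemma relations_in: "x \<in> kaehler_relations R A \<Longrightarrow> x \<in> kaehler_submodule R A"
  using F.gen_submodule_incl by (auto simp: kaehler_submodule_def)

lemma module_\<Omega>: "module R \<Omega>"
  using module_Q by (simp add: kaehler_def)

lemma d_closed: "a \<in> carrier R \<Longrightarrow> d a \<in> carrier \<Omega>"
  using proj.closed[OF free_gen_closed] by (simp add: kaehler_def kaehler_d_def)

lemma d_add:
  assumes "a \<in> carrier R" "b \<in> carrier R"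
  shows "d (a \<oplus> b) = d a \<oplus>\<^bsub>\<Omega>\<^esub> d b"
proof -
  let ?D = "free_gen R (carrier R)"
  have "?D (a \<oplus> b) \<ominus>\<^bsub>F\<^esub> (?D a \<oplus>\<^bsub>F\<^esub> ?D b) \<in> kaehler_submodule R A"
    using assms by (intro relations_in) (auto simp: kaehler_relations_def Let_def)
  then show ?thesis
    using assms by (simp add: kaehler_d_def kaehler_def proj_eq_iff free_gen_closed flip: proj_add)
qed

lemma d_mult:
  assumes "a \<in> carrier R" "b \<in> carrier R"
  shows "d (a \<otimes> b) = a \<odot>\<^bsub>\<Omega>\<^esub> d b \<oplus>\<^bsub>\<Omega>\<^esub> b \<odot>\<^bsub>\<Omega>\<^esub> d a"
proof -
  let ?D = "free_gen R (carrier R)"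
  have "?D (a \<otimes> b) \<ominus>\<^bsub>F\<^esub> (a \<odot>\<^bsub>F\<^esub> ?D b \<oplus>\<^bsub>F\<^esub> b \<odot>\<^bsub>F\<^esub> ?D a) \<in> kaehler_submodule R A"
    using assms by (intro relations_in) (auto simp: kaehler_relations_def Let_def)
  then show ?thesis
    using assms
    by (simp add: kaehler_d_def kaehler_def proj_eq_iff free_gen_closed flip: proj_add proj_smult)
qed

lemma d_const:
  assumes "a \<in> A"
  shows "d a = \<zero>\<^bsub>\<Omega>\<^esub>"
proof -
  have "free_gen R (carrier R) a \<in> kaehler_submodule R A"
    using assms by (intro relations_in) (auto simp: kaehler_relations_def Let_def)
  moreover have "a \<in> carrier R" using assms constants by blast
  ultimately show ?thesis
    by (simp add: kaehler_d_def kaehler_def proj_eq_zero_iff free_gen_closed)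
qed

lemma kaehler_generated:
  assumes "submodule H R \<Omega>" "\<And>a. a \<in> carrier R \<Longrightarrow> d a \<in> H"
  shows "carrier \<Omega> \<subseteq> H"
  unfolding kaehler_def
proof (rule generated)
  show "submodule H R Q" using assms(1) by (simp add: kaehler_def)
  show "free_gen R (carrier R) ` carrier R \<subseteq> carrier F" by (auto simp: free_gen_closed)
  show "\<pi> ` free_gen R (carrier R) ` carrier R \<subseteq> H"
    using assms(2) by (auto simp: kaehler_d_def)
qed (auto intro: free_module_generated[THEN subsetD])

text \<open>The universal property of d. The linear extension of D to the free module kills the
  three families of relations by additivity, by the Leibniz rule and by D = 0 on the constants,
  respectively.\<close>

lemma derivation_lift:
  assumes N: "module R N"
    and closed: "\<And>a. a \<in> carrier R \<Longrightarrow> D a \<in> carrier N"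
    and add: "\<And>a b. a \<in> carrier R \<Longrightarrow> b \<in> carrier R \<Longrightarrow> D (a \<oplus> b) = D a \<oplus>\<^bsub>N\<^esub> D b"
    and mult: "\<And>a b. a \<in> carrier R \<Longrightarrow> b \<in> carrier R \<Longrightarrow>
      D (a \<otimes> b) = a \<odot>\<^bsub>N\<^esub> D b \<oplus>\<^bsub>N\<^esub> b \<odot>\<^bsub>N\<^esub> D a"
    and const: "\<And>a. a \<in> A \<Longrightarrow> D a = \<zero>\<^bsub>N\<^esub>"
  obtains h where "h \<in> mod_hom R \<Omega> N" "\<And>a. a \<in> carrier R \<Longrightarrow> h (d a) = D a"
proof -
  interpret N: module R N by fact
  obtain g where g: "g \<in> mod_hom R F N" "\<And>a. a \<in> carrier R \<Longrightarrow> g (free_gen R (carrier R) a) = D a"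
    using free_module_lift[OF N, of "carrier R" D] closed by blast
  interpret g: module_hom R F N g
    using F.module_axioms N g(1) by (rule module_homI)
  have minus_self: "x \<ominus>\<^bsub>N\<^esub> x = \<zero>\<^bsub>N\<^esub>" if "x \<in> carrier N" for x
    using that by (simp add: a_minus_def N.r_neg)
  have "kaehler_submodule R A \<subseteq> {x \<in> carrier F. g x = \<zero>\<^bsub>N\<^esub>}"
    unfolding kaehler_submodule_def
  proof (rule F.gen_submodule_minimal[OF g.kernel_submodule], rule subsetI)
    fix x assume x: "x \<in> kaehler_relations R A"
    then have "g x = \<zero>\<^bsub>N\<^esub>"
      using constants unfolding kaehler_relations_def Let_def
      by (auto simp: g g.minus g.add g.smult free_gen_closed closed add mult const minus_self subset_iff)
    then show "x \<in> {x \<in> carrier F. g x = \<zero>\<^bsub>N\<^esub>}" using x relations_closed by auto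
  qed
  then have "g x = \<zero>\<^bsub>N\<^esub>" if "x \<in> kaehler_submodule R A" for x using that by blast
  from lift[OF N g(1) this] obtain h where
    "h \<in> mod_hom R Q N" "\<And>x. x \<in> carrier F \<Longrightarrow> h (\<pi> x) = g x" by blast
  then show thesis
    by (intro that[of h]) (auto simp: kaehler_def kaehler_d_def g(2) free_gen_closed)
qed

end

section \<open>Exterior powers and alternating maps\<close>

locale exterior_power = E: module R M for R (structure) and M :: "('r, 'm, 'y) module_scheme" +
  fixes q :: nat
begin

abbreviation "T \<equiv> tuples (carrier M) q"
abbreviation "F \<equiv> free_module R T"
abbreviation "\<Lambda> \<equiv> ext_power R q M"
abbreviation "w \<equiv> wedge R M"

sublocale F: module R F by (rule E.free_module_module)

lemma update_in_T: "xs \<in> T \<Longrightarrow> x \<in> carrier M \<Longrightarrow> xs[i := x] \<in> T"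
  using set_update_subset_insert[of xs i x] by (auto simp: tuples_def)

lemma nth_closed: "xs \<in> T \<Longrightarrow> i < q \<Longrightarrow> xs ! i \<in> carrier M"
  by (auto simp: tuples_def)

lemma relations_closed: "wedge_relations R q M \<subseteq> carrier F"
  by (auto simp: wedge_relations_def Let_def E.free_gen_closed update_in_T)

sublocale quotient_module R F "wedge_submodule R q M"
  by (intro quotient_module.intro F.module_axioms quotient_module_axioms.intro)
    (simp add: wedge_submodule_def F.gen_submodule_submodule relations_closed)

lemma relations_in: "x \<in> wedge_relations R q M \<Longrightarrow> x \<in> wedge_submodule R q M"
  using F.gen_submodule_incl by (auto simp: wedge_submodule_def)

lemma module_\<Lambda>: "module R \<Lambda>"
  using module_Q by (simp add: ext_power_def)

sublocale L: module R \<Lambda> by (rule module_\<Lambda>)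

lemma wedge_proj: "xs \<in> T \<Longrightarrow> w xs = \<pi> (free_gen R T xs)"
  by (simp add: wedge_def Let_def tuples_def)

lemma wedge_closed: "xs \<in> T \<Longrightarrow> w xs \<in> carrier \<Lambda>"
  using proj.closed[OF E.free_gen_closed] by (simp add: wedge_proj ext_power_def)

lemma wedge_add:
  assumes "xs \<in> T" "i < q" "x \<in> carrier M" "y \<in> carrier M"
  shows "w (xs[i := x \<oplus>\<^bsub>M\<^esub> y]) = w (xs[i := x]) \<oplus>\<^bsub>\<Lambda>\<^esub> w (xs[i := y])"
proof -
  let ?e = "free_gen R T"
  have "?e (xs[i := x \<oplus>\<^bsub>M\<^esub> y]) \<ominus>\<^bsub>F\<^esub> (?e (xs[i := x]) \<oplus>\<^bsub>F\<^esub> ?e (xs[i := y])) \<in> wedge_submodule R q M"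
    using assms by (intro relations_in) (force simp: wedge_relations_def Let_def)
  then show ?thesis
    using assms
    by (simp add: wedge_proj ext_power_def proj_eq_iff E.free_gen_closed update_in_T flip: proj_add)
qed

lemma wedge_smult:
  assumes "xs \<in> T" "i < q" "x \<in> carrier M" "r \<in> carrier R"
  shows "w (xs[i := r \<odot>\<^bsub>M\<^esub> x]) = r \<odot>\<^bsub>\<Lambda>\<^esub> w (xs[i := x])"
proof -
  let ?e = "free_gen R T"
  have "?e (xs[i := r \<odot>\<^bsub>M\<^esub> x]) \<ominus>\<^bsub>F\<^esub> r \<odot>\<^bsub>F\<^esub> ?e (xs[i := x]) \<in> wedge_submodule R q M"
    using assms by (intro relations_in) (force simp: wedge_relations_def Let_def)
  then show ?thesis
    using assms
    by (simp add: wedge_proj ext_power_def proj_eq_iff E.free_gen_closed update_in_T flip: proj_smult)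
qed

text \<open>The relations cover i < j only, while in applications the equal entries come in either
  order.\<close>

lemma wedge_repeated:
  assumes "xs \<in> T" "i < q" "j < q" "i \<noteq> j" "xs ! i = xs ! j"
  shows "w xs = \<zero>\<^bsub>\<Lambda>\<^esub>"
proof -
  have "\<exists>i j. i < j \<and> j < q \<and> xs ! i = xs ! j"
    using assms by (intro exI[of _ "min i j"] exI[of _ "max i j"]) (auto simp: min_def max_def)
  then have "free_gen R T xs \<in> wedge_submodule R q M"
    using assms by (intro relations_in) (force simp: wedge_relations_def Let_def)
  then show ?thesis
    using assms by (simp add: wedge_proj ext_power_def proj_eq_zero_iff E.free_gen_closed)
qed

lemma wedge_hom:
  assumes "xs \<in> T" "i < q"
  shows "(\<lambda>x. w (xs[i := x])) \<in> mod_hom R M \<Lambda>"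
  by (rule mod_homI) (use assms in \<open>auto simp: wedge_closed wedge_add wedge_smult update_in_T\<close>)

text \<open>Polarization: the wedge with x + y in both places vanishes, and so do two of the four
  terms of its expansion.\<close>

lemma wedge_swap:
  assumes xs: "xs \<in> T" "i < q" "j < q" "i \<noteq> j"
    and xy: "x \<in> carrier M" "y \<in> carrier M"
  shows "w (xs[i := y, j := x]) = \<ominus>\<^bsub>\<Lambda>\<^esub> w (xs[i := x, j := y])"
proof -
  have T: "xs[i := u, j := v] \<in> T" if "u \<in> carrier M" "v \<in> carrier M" for u v
    using xs that by (simp add: update_in_T)
  have eq: "w (xs[i := u, j := u]) = \<zero>\<^bsub>\<Lambda>\<^esub>" if "u \<in> carrier M" for u
    using xs T[OF that that] by (intro wedge_repeated[of _ i j]) (auto simp: tuples_def)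
  have right: "w (xs[i := u, j := x \<oplus>\<^bsub>M\<^esub> y]) = w (xs[i := u, j := x]) \<oplus>\<^bsub>\<Lambda>\<^esub> w (xs[i := u, j := y])"
    if "u \<in> carrier M" for u
    using xs xy that by (intro wedge_add update_in_T)
  have left: "w (xs[i := x \<oplus>\<^bsub>M\<^esub> y, j := v]) = w (xs[i := x, j := v]) \<oplus>\<^bsub>\<Lambda>\<^esub> w (xs[i := y, j := v])"
    if "v \<in> carrier M" for v
    using wedge_add[of "xs[j := v]" i x y] xs xy that by (simp add: update_in_T list_update_swap)
  note closed = wedge_closed[OF T]
  have "\<zero>\<^bsub>\<Lambda>\<^esub> = w (xs[i := x \<oplus>\<^bsub>M\<^esub> y, j := x \<oplus>\<^bsub>M\<^esub> y])"
    using eq xy by simp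
  also have "\<dots> = w (xs[i := x, j := x]) \<oplus>\<^bsub>\<Lambda>\<^esub> w (xs[i := y, j := x])
      \<oplus>\<^bsub>\<Lambda>\<^esub> (w (xs[i := x, j := y]) \<oplus>\<^bsub>\<Lambda>\<^esub> w (xs[i := y, j := y]))"
    using xy by (simp add: right left del: list_update_overwrite)
  also have "\<dots> = w (xs[i := x, j := y]) \<oplus>\<^bsub>\<Lambda>\<^esub> w (xs[i := y, j := x])"
    using xy closed by (simp add: eq L.a_comm)
  finally show ?thesis
    using L.minus_equality[of "w (xs[i := y, j := x])" "w (xs[i := x, j := y])"] xy closed
    by (simp add: L.a_comm)
qed

lemma ext_power_generated:
  assumes "submodule H R \<Lambda>" "\<And>xs. xs \<in> T \<Longrightarrow> w xs \<in> H"
  shows "carrier \<Lambda> \<subseteq> H"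
  unfolding ext_power_def
proof (rule generated)
  show "submodule H R Q" using assms(1) by (simp add: ext_power_def)
  show "free_gen R T ` T \<subseteq> carrier F" by (auto simp: E.free_gen_closed)
  show "\<pi> ` free_gen R T ` T \<subseteq> H"
    using assms(2) by (auto simp: wedge_proj)
qed (auto intro: E.free_module_generated[THEN subsetD])

text \<open>The universal property of the exterior power, proved like
  \<open>derivation_lift\<close>.\<close>

lemma alternating_lift:
  assumes N: "module R N"
    and closed: "\<And>xs. xs \<in> T \<Longrightarrow> \<phi> xs \<in> carrier N"
    and add: "\<And>xs i x y. xs \<in> T \<Longrightarrow> i < q \<Longrightarrow> x \<in> carrier M \<Longrightarrow> y \<in> carrier M \<Longrightarrow>
      \<phi> (xs[i := x \<oplus>\<^bsub>M\<^esub> y]) = \<phi> (xs[i := x]) \<oplus>\<^bsub>N\<^esub> \<phi> (xs[i := y])"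
    and smult: "\<And>xs i r x. xs \<in> T \<Longrightarrow> i < q \<Longrightarrow> r \<in> carrier R \<Longrightarrow> x \<in> carrier M \<Longrightarrow>
      \<phi> (xs[i := r \<odot>\<^bsub>M\<^esub> x]) = r \<odot>\<^bsub>N\<^esub> \<phi> (xs[i := x])"
    and repeated: "\<And>xs i j. xs \<in> T \<Longrightarrow> i < j \<Longrightarrow> j < q \<Longrightarrow> xs ! i = xs ! j \<Longrightarrow> \<phi> xs = \<zero>\<^bsub>N\<^esub>"
  obtains h where "h \<in> mod_hom R \<Lambda> N" "\<And>xs. xs \<in> T \<Longrightarrow> h (w xs) = \<phi> xs"
proof -
  interpret N: module R N by fact
  obtain g where g: "g \<in> mod_hom R F N" "\<And>xs. xs \<in> T \<Longrightarrow> g (free_gen R T xs) = \<phi> xs"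
    using E.free_module_lift[OF N, of T \<phi>] closed by blast
  interpret g: module_hom R F N g
    using F.module_axioms N g(1) by (rule module_homI)
  have minus_self: "x \<ominus>\<^bsub>N\<^esub> x = \<zero>\<^bsub>N\<^esub>" if "x \<in> carrier N" for x
    using that by (simp add: a_minus_def N.r_neg)
  have "wedge_submodule R q M \<subseteq> {x \<in> carrier F. g x = \<zero>\<^bsub>N\<^esub>}"
    unfolding wedge_submodule_def
  proof (rule F.gen_submodule_minimal[OF g.kernel_submodule], rule subsetI)
    fix x assume x: "x \<in> wedge_relations R q M"
    then have "g x = \<zero>\<^bsub>N\<^esub>"
      unfolding wedge_relations_def Let_def
      by (auto simp: g g.minus g.add g.smult E.free_gen_closed update_in_T closed add smult repeated
          minus_self)
    then show "x \<in> {x \<in> carrier F. g x = \<zero>\<^bsub>N\<^esub>}" using x relations_closed by auto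
  qed
  then have "g x = \<zero>\<^bsub>N\<^esub>" if "x \<in> wedge_submodule R q M" for x using that by blast
  from lift[OF N g(1) this] obtain h where
    "h \<in> mod_hom R Q N" "\<And>x. x \<in> carrier F \<Longrightarrow> h (\<pi> x) = g x" by blast
  then show thesis
    by (intro that[of h]) (auto simp: ext_power_def wedge_proj g(2) E.free_gen_closed)
qed

end

section \<open>The polynomial ring and its partial derivatives\<close>

lemma poly_ring_simps [simp]:
  "(\<otimes>\<^bsub>poly_ring n\<^esub>) = (*)" "\<one>\<^bsub>poly_ring n\<^esub> = 1" "\<zero>\<^bsub>poly_ring n\<^esub> = 0" "(\<oplus>\<^bsub>poly_ring n\<^esub>) = (+)"
  by (simp_all add: poly_ring_def)

lemma in_poly_ring:
  "F \<in> carrier (poly_ring n) \<longleftrightarrow> (\<forall>\<alpha>\<in>Poly_Mapping.keys F. Poly_Mapping.keys \<alpha> \<subseteq> {..n})"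
  by (simp add: poly_ring_def)

lemma poly_ring_closed [simp, intro]:
  fixes F G :: "'k::field mpoly"
  shows "0 \<in> carrier (poly_ring n)" "1 \<in> carrier (poly_ring n)"
    and "F \<in> carrier (poly_ring n) \<Longrightarrow> G \<in> carrier (poly_ring n) \<Longrightarrow> F + G \<in> carrier (poly_ring n)"
    and "F \<in> carrier (poly_ring n) \<Longrightarrow> - F \<in> carrier (poly_ring n)"
    and "F \<in> carrier (poly_ring n) \<Longrightarrow> G \<in> carrier (poly_ring n) \<Longrightarrow> F - G \<in> carrier (poly_ring n)"
    and "F \<in> carrier (poly_ring n) \<Longrightarrow> G \<in> carrier (poly_ring n) \<Longrightarrow> F * G \<in> carrier (poly_ring n)"
proof -
  show "F + G \<in> carrier (poly_ring n)"
    if "F \<in> carrier (poly_ring n)" "G \<in> carrier (poly_ring n)"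
    using that keys_add[of F G] by (auto simp: in_poly_ring)
  show neg: "- F \<in> carrier (poly_ring n)" if "F \<in> carrier (poly_ring n)" for F :: "'k mpoly"
    using that by (auto simp: in_poly_ring in_keys_iff)
  then show "F - G \<in> carrier (poly_ring n)"
    if "F \<in> carrier (poly_ring n)" "G \<in> carrier (poly_ring n)"
    using that keys_add[of F "- G"] neg[OF that(2)] by (fastforce simp: in_poly_ring)
  show "F * G \<in> carrier (poly_ring n)"
    if "F \<in> carrier (poly_ring n)" "G \<in> carrier (poly_ring n)"
  proof -
    have "Poly_Mapping.keys \<gamma> \<subseteq> {..n}" if \<gamma>: "\<gamma> \<in> Poly_Mapping.keys (F * G)" for \<gamma>
    proof -
      obtain \<alpha> \<beta> where "\<gamma> = \<alpha> + \<beta>" "\<alpha> \<in> Poly_Mapping.keys F" "\<beta> \<in> Poly_Mapping.keys G"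
        using \<gamma> keys_mult[of F G] by blast
      then show ?thesis
        using \<open>F \<in> _\<close> \<open>G \<in> _\<close> keys_add[of \<alpha> \<beta>] unfolding in_poly_ring by blast
    qed
    then show ?thesis by (auto simp: in_poly_ring)
  qed
qed (auto simp: in_poly_ring)

lemma poly_ring_sum [intro]:
  "(\<And>x. x \<in> A \<Longrightarrow> f x \<in> carrier (poly_ring n)) \<Longrightarrow> sum f A \<in> carrier (poly_ring n)"
  by (induction A rule: infinite_finite_induct) auto

lemma poly_ring_prod [intro]:
  "(\<And>x. x \<in> A \<Longrightarrow> f x \<in> carrier (poly_ring n)) \<Longrightarrow> prod f A \<in> carrier (poly_ring n)"
  by (induction A rule: infinite_finite_induct) auto

lemma poly_const_closed [simp, intro]: "poly_const c \<in> carrier (poly_ring n)"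
  by (simp add: in_poly_ring poly_const_def)

lemma poly_var_closed [intro]: "i \<le> n \<Longrightarrow> poly_var i \<in> carrier (poly_ring n)"
  by (simp add: in_poly_ring poly_var_def)

lemma poly_const_simps:
  "poly_const 0 = 0" "poly_const 1 = 1" "poly_const (a + b) = poly_const a + poly_const b"
  "poly_const (a * b) = poly_const a * poly_const b"
  by (simp_all add: poly_const_def single_add mult_single)

lemma cring_poly_ring: "cring (poly_ring n :: 'k::field mpoly ring)"
proof (rule cringI)
  show "abelian_group (poly_ring n :: 'k mpoly ring)"
  proof (rule abelian_groupI)
    fix F :: "'k mpoly" assume "F \<in> carrier (poly_ring n)"
    then show "\<exists>G\<in>carrier (poly_ring n). G \<oplus>\<^bsub>poly_ring n\<^esub> F = \<zero>\<^bsub>poly_ring n\<^esub>"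
      by (intro bexI[of _ "- F"]) auto
  qed (auto simp: add_ac)
  show "comm_monoid (poly_ring n :: 'k mpoly ring)"
    by (rule comm_monoidI) (auto simp: mult_ac)
qed (auto simp: distrib_right)

interpretation poly_ring: cring "poly_ring n :: 'k::field mpoly ring" for n
  by (rule cring_poly_ring)

lemma a_inv_poly_ring [simp]:
  "F \<in> carrier (poly_ring n) \<Longrightarrow> \<ominus>\<^bsub>poly_ring n\<^esub> F = - F"
  by (rule poly_ring.minus_equality) simp_all

lemma poly_mapping_sum_single:
  fixes F :: "'a \<Rightarrow>\<^sub>0 'b::comm_monoid_add"
  shows "F = (\<Sum>\<alpha>\<in>Poly_Mapping.keys F. Poly_Mapping.single \<alpha> (Poly_Mapping.lookup F \<alpha>))"
proof (rule poly_mapping_eqI)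
  fix \<beta>
  have "(\<Sum>\<alpha>\<in>Poly_Mapping.keys F. Poly_Mapping.lookup F \<alpha> when \<alpha> = \<beta>) = Poly_Mapping.lookup F \<beta>"
    by (cases "\<beta> \<in> Poly_Mapping.keys F") (auto simp: when_def in_keys_iff sum.delta')
  then show "Poly_Mapping.lookup F \<beta> =
    Poly_Mapping.lookup (\<Sum>\<alpha>\<in>Poly_Mapping.keys F. Poly_Mapping.single \<alpha> (Poly_Mapping.lookup F \<alpha>)) \<beta>"
    by (simp add: lookup_sum lookup_single)
qed

text \<open>Only exponents from the support of F occur, so that an induction over a polynomial in
  X_0, ..., X_n does not leave these variables.\<close>

lemma poly_mapping_single_induct [case_names zero single add]:
  fixes F :: "'a \<Rightarrow>\<^sub>0 'b::comm_monoid_add"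
  assumes "P 0" "\<And>\<alpha> a. \<alpha> \<in> Poly_Mapping.keys F \<Longrightarrow> P (Poly_Mapping.single \<alpha> a)"
    "\<And>G H. P G \<Longrightarrow> P H \<Longrightarrow> P (G + H)"
  shows "P F"
proof -
  have "P (\<Sum>\<alpha>\<in>A. Poly_Mapping.single \<alpha> (Poly_Mapping.lookup F \<alpha>))" if "A \<subseteq> Poly_Mapping.keys F" for A
    using finite_subset[OF that finite_keys] that by (induction A rule: finite_induct) (auto intro: assms)
  then show ?thesis using poly_mapping_sum_single[of F] by fastforce
qed

text \<open>The ring is generated by constants and variables: monomials are treated by induction on
  the total degree, and sums of monomials after that.\<close>

lemma poly_ring_induct [consumes 1, case_names const var add mult]:
  fixes F :: "'k::field mpoly"
  assumes F: "F \<in> carrier (poly_ring n)"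
    and const: "\<And>c. P (poly_const c)" and var: "\<And>i. i \<le> n \<Longrightarrow> P (poly_var i)"
    and add: "\<And>G H. G \<in> carrier (poly_ring n) \<Longrightarrow> H \<in> carrier (poly_ring n) \<Longrightarrow> P G \<Longrightarrow> P H \<Longrightarrow> P (G + H)"
    and mult: "\<And>G H. G \<in> carrier (poly_ring n) \<Longrightarrow> H \<in> carrier (poly_ring n) \<Longrightarrow> P G \<Longrightarrow> P H \<Longrightarrow> P (G * H)"
  shows "P F"
proof -
  have mono: "P (Poly_Mapping.single \<alpha> a)" if "Poly_Mapping.keys \<alpha> \<subseteq> {..n}" for \<alpha> :: "nat \<Rightarrow>\<^sub>0 nat" and a :: 'k
    using that
  proof (induction "\<Sum>i\<le>n. Poly_Mapping.lookup \<alpha> i" arbitrary: \<alpha>)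
    case 0
    have "Poly_Mapping.lookup \<alpha> i = 0" for i
      using 0 by (cases "i \<le> n") (auto simp: in_keys_iff subset_iff)
    then have "\<alpha> = 0" by (simp add: poly_mapping_eq_iff fun_eq_iff)
    then show ?case using const by (simp add: poly_const_def)
  next
    case (Suc s)
    then obtain i where i: "i \<le> n" "Poly_Mapping.lookup \<alpha> i > 0"
      by (metis atMost_iff gr0I nat.distinct(1) sum.neutral)
    \<comment> \<open>Divide the monomial by a variable X_i that occurs in it, so that the truncated
      subtraction loses nothing.\<close>
    define \<beta> where "\<beta> = \<alpha> - Poly_Mapping.single i 1"
    have lookup: "Poly_Mapping.lookup \<beta> j = (if j = i then Poly_Mapping.lookup \<alpha> j - 1 else Poly_Mapping.lookup \<alpha> j)"
      for j by (simp add: \<beta>_def lookup_minus lookup_single when_def)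
    have \<alpha>: "\<alpha> = Poly_Mapping.single i 1 + \<beta>"
      by (rule poly_mapping_eqI) (use i in \<open>auto simp: lookup_add lookup lookup_single when_def\<close>)
    have "(\<Sum>i\<le>n. Poly_Mapping.lookup \<alpha> i) = 1 + (\<Sum>i\<le>n. Poly_Mapping.lookup \<beta> i)"
      using i by (simp add: \<alpha> lookup_add sum.distrib lookup_single when_def)
    moreover have keys: "Poly_Mapping.keys \<beta> \<subseteq> {..n}"
      using Suc.prems by (force simp: in_keys_iff lookup subset_iff split: if_splits)
    ultimately have "P (Poly_Mapping.single \<beta> a)" using Suc.hyps by simp
    moreover have "Poly_Mapping.single \<alpha> a = poly_var i * Poly_Mapping.single \<beta> a"
      by (simp add: poly_var_def mult_single \<alpha>)
    moreover have "Poly_Mapping.single \<beta> a \<in> carrier (poly_ring n)"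
      using keys by (simp add: in_poly_ring)
    ultimately show ?case using var[OF i(1)] mult poly_var_closed[OF i(1)] by simp
  qed
  \<comment> \<open>Membership in the ring is carried along because the case \<open>add\<close>
    applies to members only.\<close>
  have "F \<in> carrier (poly_ring n) \<and> P F"
  proof (induction F rule: poly_mapping_single_induct)
    case zero
    show ?case using const[of 0] by (simp add: poly_const_simps)
  next
    case (single \<alpha> a)
    then show ?case using F mono by (simp add: in_poly_ring)
  qed (use add in auto)
  then show ?thesis ..
qed

text \<open>Given by coefficients: X^(\<alpha> + e_j) is the only monomial whose derivative can
  contribute to X^\<alpha>. Linearity is then read off coefficientwise.\<close>

definition partial_deriv :: "nat \<Rightarrow> 'k::field mpoly \<Rightarrow> 'k mpoly" where
  "partial_deriv j F = Abs_poly_mapping (\<lambda>\<alpha>. of_nat (Poly_Mapping.lookup \<alpha> j + 1)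
     * Poly_Mapping.lookup F (\<alpha> + Poly_Mapping.single j 1))"

text \<open>The shift of exponents is injective, so the support of the coefficient function is
  finite and \<open>Abs_poly_mapping\<close> may be unfolded.\<close>

lemma lookup_partial_deriv:
  "Poly_Mapping.lookup (partial_deriv j F) \<alpha> =
    of_nat (Poly_Mapping.lookup \<alpha> j + 1) * Poly_Mapping.lookup F (\<alpha> + Poly_Mapping.single j 1)"
proof -
  have "finite ((\<lambda>\<alpha>. \<alpha> + Poly_Mapping.single j 1) -` Poly_Mapping.keys F)"
    by (rule finite_vimageI) (auto simp: inj_on_def)
  then have "finite {\<alpha>. of_nat (Poly_Mapping.lookup \<alpha> j + 1)
     * Poly_Mapping.lookup F (\<alpha> + Poly_Mapping.single j 1) \<noteq> 0}"
    by (rule finite_subset[rotated]) (auto simp: in_keys_iff)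
  then show ?thesis by (simp add: partial_deriv_def)
qed

lemma partial_deriv_closed [simp, intro]:
  assumes "F \<in> carrier (poly_ring n)"
  shows "partial_deriv j F \<in> carrier (poly_ring n)"
  unfolding in_poly_ring
proof
  fix \<alpha> assume "\<alpha> \<in> Poly_Mapping.keys (partial_deriv j F)"
  then have "\<alpha> + Poly_Mapping.single j 1 \<in> Poly_Mapping.keys F"
    by (auto simp: in_keys_iff lookup_partial_deriv)
  then have "Poly_Mapping.keys (\<alpha> + Poly_Mapping.single j 1) \<subseteq> {..n}"
    using assms by (auto simp: in_poly_ring)
  moreover have "Poly_Mapping.keys \<alpha> \<subseteq> Poly_Mapping.keys (\<alpha> + Poly_Mapping.single j 1)"
    by (auto simp: in_keys_iff lookup_add)
  ultimately show "Poly_Mapping.keys \<alpha> \<subseteq> {..n}" by blast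
qed

lemma partial_deriv_add: "partial_deriv j (F + G) = partial_deriv j F + partial_deriv j G"
  by (rule poly_mapping_eqI) (simp add: lookup_partial_deriv lookup_add ring_distribs)

lemma partial_deriv_minus: "partial_deriv j (F - G) = partial_deriv j F - partial_deriv j G"
  by (rule poly_mapping_eqI) (simp add: lookup_partial_deriv lookup_minus ring_distribs)

lemma partial_deriv_zero [simp]: "partial_deriv j 0 = 0"
  by (rule poly_mapping_eqI) (simp add: lookup_partial_deriv)

text \<open>Exponents are subtracted with truncation. If X_j does not occur, the resulting exponent
  is meaningless, but the coefficient is zero.\<close>

lemma partial_deriv_single:
  "partial_deriv j (Poly_Mapping.single \<alpha> a) =
    Poly_Mapping.single (\<alpha> - Poly_Mapping.single j 1) (of_nat (Poly_Mapping.lookup \<alpha> j) * a)"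
proof (cases "Poly_Mapping.lookup \<alpha> j = 0")
  case True
  then have "\<alpha> \<noteq> \<beta> + Poly_Mapping.single j 1" for \<beta>
    by (metis add_is_0 lookup_add lookup_single_eq one_neq_zero)
  then show ?thesis
    using True by (intro poly_mapping_eqI) (simp add: lookup_partial_deriv lookup_single when_def)
next
  case False
  define \<gamma> where "\<gamma> = \<alpha> - Poly_Mapping.single j 1"
  have "\<alpha> = \<gamma> + Poly_Mapping.single j 1"
    unfolding \<gamma>_def by (rule poly_mapping_eqI)
      (use False in \<open>auto simp: lookup_add lookup_minus lookup_single when_def\<close>)
  then show ?thesis
    by (intro poly_mapping_eqI)
      (auto simp: lookup_partial_deriv lookup_add lookup_single when_def)
qed

lemma partial_deriv_const [simp]: "partial_deriv j (poly_const c) = 0"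
  by (simp add: poly_const_def partial_deriv_single)

lemma partial_deriv_var: "partial_deriv j (poly_var i) = (if i = j then 1 else 0)"
  by (simp add: poly_var_def partial_deriv_single lookup_single)

text \<open>Both sides are additive in F and in G, which reduces the Leibniz rule to
  monomials.\<close>

lemma partial_deriv_mult:
  "partial_deriv j (F * G) = F * partial_deriv j G + G * partial_deriv j F"
proof -
  have single: "partial_deriv j (Poly_Mapping.single \<alpha> a * Poly_Mapping.single \<beta> b) =
      Poly_Mapping.single \<alpha> a * partial_deriv j (Poly_Mapping.single \<beta> b)
      + Poly_Mapping.single \<beta> b * partial_deriv j (Poly_Mapping.single \<alpha> a)" for \<alpha> \<beta> and a b :: 'a
  proof -
    let ?e = "Poly_Mapping.single j 1 :: nat \<Rightarrow>\<^sub>0 nat"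
    \<comment> \<open>Truncated subtraction can break the identity of exponents only if X_j does not
      occur, and then the term has coefficient zero.\<close>
    have shift: "Poly_Mapping.lookup \<alpha> j = 0 \<or> \<beta> + (\<alpha> - ?e) = \<alpha> + \<beta> - ?e" for \<alpha> \<beta> :: "nat \<Rightarrow>\<^sub>0 nat"
      by (auto simp: poly_mapping_eq_iff fun_eq_iff lookup_add lookup_minus lookup_single when_def)
    show ?thesis
      using shift[of \<alpha> \<beta>] shift[of \<beta> \<alpha>]
      by (auto simp: partial_deriv_single mult_single lookup_add ring_distribs single_add mult_ac add_ac)
  qed
  have "partial_deriv j (Poly_Mapping.single \<alpha> a * G) =
      Poly_Mapping.single \<alpha> a * partial_deriv j G + G * partial_deriv j (Poly_Mapping.single \<alpha> a)"
    for \<alpha> and a :: 'a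
    by (induction G rule: poly_mapping_single_induct)
      (simp_all add: single partial_deriv_add ring_distribs)
  then show ?thesis
    by (induction F rule: poly_mapping_single_induct)
      (simp_all add: partial_deriv_add ring_distribs)
qed

lemma partial_deriv_power:
  "partial_deriv j (F ^ Suc k) = of_nat (Suc k) * F ^ k * partial_deriv j F"
proof (induction k)
  case (Suc k)
  have "partial_deriv j (F ^ Suc (Suc k)) = F * partial_deriv j (F ^ Suc k) + F ^ Suc k * partial_deriv j F"
    by (simp only: power_Suc[of F "Suc k"] partial_deriv_mult)
  then show ?case unfolding Suc.IH by (simp add: algebra_simps)
qed simp

text \<open>Each derivative lowers the degree in X_j, so any strict bound r for this degree will do;
  it depends on F.\<close>

lemma partial_deriv_nilpotent: "\<exists>r. (partial_deriv j ^^ r) F = 0"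
proof -
  have vanish: "(partial_deriv j ^^ r) F = 0"
    if "\<And>\<alpha>. \<alpha> \<in> Poly_Mapping.keys F \<Longrightarrow> Poly_Mapping.lookup \<alpha> j < r" for r F
    using that
  proof (induction r arbitrary: F)
    case 0
    then have "Poly_Mapping.keys F = {}" by blast
    then show ?case by simp
  next
    case (Suc r)
    have "Poly_Mapping.lookup \<alpha> j < r" if "\<alpha> \<in> Poly_Mapping.keys (partial_deriv j F)" for \<alpha>
      using that Suc.prems[of "\<alpha> + Poly_Mapping.single j 1"]
      by (auto simp: in_keys_iff lookup_partial_deriv lookup_add)
    then show ?case using Suc.IH by (simp add: funpow_swap1)
  qed
  have "finite ((\<lambda>\<alpha>. Poly_Mapping.lookup \<alpha> j) ` Poly_Mapping.keys F)" by simp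
  then obtain r where "\<forall>k\<in>(\<lambda>\<alpha>. Poly_Mapping.lookup \<alpha> j) ` Poly_Mapping.keys F. k < r"
    using finite_nat_set_iff_bounded by metis
  then show ?thesis by (intro exI[of _ r] vanish) auto
qed

section \<open>Homogeneous polynomials\<close>

lemma homog_part_closed: "F \<in> homog_part n d \<Longrightarrow> F \<in> carrier (poly_ring n)"
  by (simp add: homog_part_def)

lemma homog_part_zero [simp]: "0 \<in> homog_part n d"
  by (simp add: homog_part_def)

lemma homog_part_add: "F \<in> homog_part n d \<Longrightarrow> G \<in> homog_part n d \<Longrightarrow> F + G \<in> homog_part n d"
  using keys_add[of F G] by (auto simp: homog_part_def)

lemma homog_part_uminus: "F \<in> homog_part n d \<Longrightarrow> - F \<in> homog_part n d"
  by (auto simp: homog_part_def in_keys_iff)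

lemma homog_part_mult:
  assumes "F \<in> homog_part n d" "G \<in> homog_part n e"
  shows "F * G \<in> homog_part n (d + e)"
proof -
  have "int (\<Sum>i\<le>n. Poly_Mapping.lookup \<gamma> i) = d + e" if \<gamma>: "\<gamma> \<in> Poly_Mapping.keys (F * G)" for \<gamma>
  proof -
    obtain \<alpha> \<beta> where "\<gamma> = \<alpha> + \<beta>" "\<alpha> \<in> Poly_Mapping.keys F" "\<beta> \<in> Poly_Mapping.keys G"
      using \<gamma> keys_mult[of F G] by blast
    then show ?thesis
      using assms by (auto simp: homog_part_def lookup_add sum.distrib)
  qed
  then show ?thesis using assms by (auto simp: homog_part_def)
qed

lemma homog_part_const: "poly_const c \<in> homog_part n 0"
  by (auto simp: homog_part_def poly_const_def in_poly_ring)

lemma homog_part_one: "1 \<in> homog_part n 0"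
  using homog_part_const[of 1] by (simp add: poly_const_simps)

lemma homog_part_var: "i \<le> n \<Longrightarrow> poly_var i \<in> homog_part n 1"
  by (auto simp: homog_part_def poly_var_def in_poly_ring lookup_single when_def
      simp flip: of_nat_sum)

lemma homog_part_sum:
  "(\<And>x. x \<in> A \<Longrightarrow> f x \<in> homog_part n d) \<Longrightarrow> sum f A \<in> homog_part n d"
  by (induction A rule: infinite_finite_induct) (auto intro: homog_part_add)

lemma homog_part_prod:
  "finite A \<Longrightarrow> (\<And>x. x \<in> A \<Longrightarrow> f x \<in> homog_part n (d x)) \<Longrightarrow> prod f A \<in> homog_part n (sum d A)"
  by (induction A rule: finite_induct) (auto intro: homog_part_mult homog_part_one)


section \<open>Determinants of polynomial matrices\<close>

text \<open>The Leibniz formula. The size depends on the number of variables of the ring, so a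
  matrix is a function of two indices, read below N only.\<close>

definition poly_det :: "nat \<Rightarrow> (nat \<Rightarrow> nat \<Rightarrow> 'k::field mpoly) \<Rightarrow> 'k mpoly" where
  "poly_det N A = (\<Sum>p | p permutes {..<N}. of_int (sign p) * (\<Prod>i<N. A i (p i)))"

lemma poly_det_closed:
  assumes "\<And>i j. i < N \<Longrightarrow> j < N \<Longrightarrow> A i j \<in> carrier (poly_ring n)"
  shows "poly_det N A \<in> carrier (poly_ring n)"
  unfolding poly_det_def
proof (intro poly_ring_sum poly_ring_closed(6) poly_ring_prod)
  fix p
  show "of_int (sign p) \<in> carrier (poly_ring n)" by (cases p rule: sign_cases) auto
qed (use assms permutes_in_image in fastforce)

text \<open>The degree of an entry depends on its row only, and each product takes one entry from
  every row.\<close>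

lemma poly_det_homog:
  assumes "\<And>i j. i < N \<Longrightarrow> j < N \<Longrightarrow> A i j \<in> homog_part n (d i)"
  shows "poly_det N A \<in> homog_part n (\<Sum>i<N. d i)"
  unfolding poly_det_def
proof (rule homog_part_sum)
  fix p assume "p \<in> {p. p permutes {..<N}}"
  then have "(\<Prod>i<N. A i (p i)) \<in> homog_part n (\<Sum>i<N. d i)"
    using assms permutes_in_image by (intro homog_part_prod) fastforce+
  then show "of_int (sign p) * (\<Prod>i<N. A i (p i)) \<in> homog_part n (\<Sum>i<N. d i)"
    by (cases p rule: sign_cases) (auto intro: homog_part_uminus)
qed

text \<open>Each product in the Leibniz formula has exactly one factor from row k, which is split
  off.\<close>

lemma poly_det_row_add:
  fixes A :: "nat \<Rightarrow> nat \<Rightarrow> 'k::field mpoly"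
  assumes k: "k < N"
    and row: "\<And>j. j < N \<Longrightarrow> A k j = B k j + C k j"
    and other: "\<And>i j. i < N \<Longrightarrow> j < N \<Longrightarrow> i \<noteq> k \<Longrightarrow> A i j = B i j" "\<And>i j. i < N \<Longrightarrow> j < N \<Longrightarrow> i \<noteq> k \<Longrightarrow> A i j = C i j"
  shows "poly_det N A = poly_det N B + poly_det N C"
proof -
  have "(\<Prod>i<N. A i (p i)) = (\<Prod>i<N. B i (p i)) + (\<Prod>i<N. C i (p i))" if "p permutes {..<N}" for p
  proof -
    have p: "p i < N" if "i < N" for i using permutes_in_image[OF \<open>p permutes _\<close>, of i] that by simp
    have split: "(\<Prod>i<N. f i) = f k * (\<Prod>i\<in>{..<N} - {k}. f i)" for f :: "nat \<Rightarrow> 'k mpoly"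
      using k by (intro prod.remove) auto
    have "(\<Prod>i\<in>{..<N} - {k}. B i (p i)) = (\<Prod>i\<in>{..<N} - {k}. A i (p i))"
      "(\<Prod>i\<in>{..<N} - {k}. C i (p i)) = (\<Prod>i\<in>{..<N} - {k}. A i (p i))"
      by (rule prod.cong; use other p in auto)+
    then show ?thesis
      using p k by (simp add: split row distrib_right)
  qed
  then show ?thesis
    by (simp add: poly_det_def distrib_left flip: sum.distrib)
qed

lemma poly_det_row_mult:
  fixes A :: "nat \<Rightarrow> nat \<Rightarrow> 'k::field mpoly"
  assumes k: "k < N"
    and row: "\<And>j. j < N \<Longrightarrow> A k j = c * B k j"
    and other: "\<And>i j. i < N \<Longrightarrow> j < N \<Longrightarrow> i \<noteq> k \<Longrightarrow> A i j = B i j"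
  shows "poly_det N A = c * poly_det N B"
proof -
  have "(\<Prod>i<N. A i (p i)) = c * (\<Prod>i<N. B i (p i))" if "p permutes {..<N}" for p
  proof -
    have p: "p i < N" if "i < N" for i using permutes_in_image[OF \<open>p permutes _\<close>, of i] that by simp
    have split: "(\<Prod>i<N. f i) = f k * (\<Prod>i\<in>{..<N} - {k}. f i)" for f :: "nat \<Rightarrow> 'k mpoly"
      using k by (intro prod.remove) auto
    have "(\<Prod>i\<in>{..<N} - {k}. B i (p i)) = (\<Prod>i\<in>{..<N} - {k}. A i (p i))"
      by (rule prod.cong; use other p in auto)
    then show ?thesis
      using p k by (simp add: split row mult_ac)
  qed
  then show ?thesis
    by (simp add: poly_det_def sum_distrib_left mult_ac)
qed

text \<open>Composition with the transposition of k and l permutes the summands; it keeps the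
  products, as the two rows agree, and reverses the signs. The determinant is thus its own negative,
  and characteristic zero, used on each coefficient, makes it vanish.\<close>

lemma poly_det_identical_rows:
  fixes A :: "nat \<Rightarrow> nat \<Rightarrow> 'k::field_char_0 mpoly"
  assumes kl: "k < N" "l < N" "k \<noteq> l" and rows: "\<And>j. j < N \<Longrightarrow> A k j = A l j"
  shows "poly_det N A = 0"
proof -
  let ?t = "transpose k l" and ?P = "{p. p permutes {..<N}}"
  let ?f = "\<lambda>p. of_int (sign p) * (\<Prod>i<N. A i (p i))"
  have t: "?t permutes {..<N}" using kl by (intro permutes_swap_id) auto
  have "bij_betw (\<lambda>p. p \<circ> ?t) ?P ?P"
    by (rule bij_betw_byWitness[of _ "\<lambda>p. p \<circ> ?t"])
      (auto simp: o_assoc[symmetric] intro: permutes_compose[OF t])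
  then have "poly_det N A = (\<Sum>p\<in>?P. ?f (p \<circ> ?t))"
    unfolding poly_det_def by (rule sum.reindex_bij_betw[symmetric])
  also have "\<dots> = (\<Sum>p\<in>?P. - ?f p)"
  proof (rule sum.cong)
    fix p assume "p \<in> ?P"
    then have p: "p permutes {..<N}" by simp
    have "(\<Prod>i<N. A i ((p \<circ> ?t) i)) = (\<Prod>i<N. A (?t i) (p i))"
      by (subst prod.permute[OF t]) (simp add: o_def)
    also have "\<dots> = (\<Prod>i<N. A i (p i))"
      using rows permutes_in_image[OF p] by (intro prod.cong) (auto simp: transpose_def)
    finally have eq: "(\<Prod>i<N. A i ((p \<circ> ?t) i)) = (\<Prod>i<N. A i (p i))" .
    have "sign (p \<circ> ?t) = - sign p"
      using p t kl by (simp add: sign_compose permutation_permutes[THEN iffD2] sign_swap_id exI[of _ "{..<N}"])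
    then show "?f (p \<circ> ?t) = - ?f p" using eq by simp
  qed simp
  also have "\<dots> = - poly_det N A"
    by (simp add: poly_det_def sum_negf)
  finally have eq: "poly_det N A = - poly_det N A" .
  have "Poly_Mapping.lookup (poly_det N A) \<alpha> = 0" for \<alpha>
  proof -
    have "Poly_Mapping.lookup (poly_det N A) \<alpha> = - Poly_Mapping.lookup (poly_det N A) \<alpha>"
      by (subst eq) simp
    then have "2 * Poly_Mapping.lookup (poly_det N A) \<alpha> = 0"
      by (metis add.right_inverse mult_2)
    then show ?thesis by simp
  qed
  then show ?thesis by (intro poly_mapping_eqI) simp
qed

lemma poly_det_one:
  assumes "\<And>i j. i < N \<Longrightarrow> j < N \<Longrightarrow> A i j = (if i = j then 1 else 0)"
  shows "poly_det N A = 1"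
proof -
  have "(\<Prod>i<N. A i (p i)) = (if p = id then 1 else 0)" if p: "p permutes {..<N}" for p
  proof (cases "p = id")
    case True
    then show ?thesis using assms by simp
  next
    case False
    then obtain i where i: "p i \<noteq> i" by (auto simp: fun_eq_iff)
    then have "i < N" using permutes_not_in[OF p, of i] by auto
    then have "A i (p i) = 0" using assms i permutes_in_image[OF p, of i] by auto
    then show ?thesis using \<open>i < N\<close> False by (auto intro: prod_zero)
  qed
  then have "poly_det N A = (\<Sum>p | p permutes {..<N}. if p = id then 1 else 0)"
    unfolding poly_det_def by (intro sum.cong) auto
  then show ?thesis by (simp add: permutes_id finite_permutations sum.delta')
qed

section \<open>Ideals of the polynomial ring\<close>

locale poly_ideal =
  fixes n :: nat and I :: "'k::field mpoly set"
  assumes ideal: "ideal I (poly_ring n)"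
begin

sublocale ideal I "poly_ring n" by (rule ideal)

lemma closed_carrier: "F \<in> I \<Longrightarrow> F \<in> carrier (poly_ring n)"
  by (rule a_Hcarr)

lemma zero_in [simp]: "0 \<in> I"
  using zero_closed by simp

lemma add_in: "F \<in> I \<Longrightarrow> G \<in> I \<Longrightarrow> F + G \<in> I"
  using a_closed[of F G] by simp

lemma uminus_in: "F \<in> I \<Longrightarrow> - F \<in> I"
  using a_inv_closed[of F] by (simp add: closed_carrier)

lemma minus_in: "F \<in> I \<Longrightarrow> G \<in> I \<Longrightarrow> F - G \<in> I"
  using add_in[OF _ uminus_in, of F G] by simp

lemma mult_in: "F \<in> I \<Longrightarrow> G \<in> carrier (poly_ring n) \<Longrightarrow> G * F \<in> I"
  using I_l_closed[of F G] by simp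

lemma sum_in: "(\<And>x. x \<in> A \<Longrightarrow> f x \<in> I) \<Longrightarrow> sum f A \<in> I"
  by (induction A rule: infinite_finite_induct) (auto intro: add_in)

lemma prod_cong_mod:
  assumes "\<And>x. x \<in> A \<Longrightarrow> f x \<in> carrier (poly_ring n)" "\<And>x. x \<in> A \<Longrightarrow> g x \<in> carrier (poly_ring n)"
    and "\<And>x. x \<in> A \<Longrightarrow> f x - g x \<in> I"
  shows "prod f A - prod g A \<in> I"
  using assms
proof (induction A rule: infinite_finite_induct)
  case (insert a A)
  have "prod f (insert a A) - prod g (insert a A) = f a * (prod f A - prod g A) + prod g A * (f a - g a)"
    using insert.hyps by (simp add: algebra_simps)
  moreover have "prod g A \<in> carrier (poly_ring n)" using insert.prems by auto
  ultimately show ?case using insert by (simp add: add_in mult_in)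
qed simp_all

text \<open>This makes determinants over S/I well defined when they are computed on
  representatives.\<close>

lemma poly_det_cong_mod:
  assumes "\<And>i j. i < N \<Longrightarrow> j < N \<Longrightarrow> A i j \<in> carrier (poly_ring n)"
    and "\<And>i j. i < N \<Longrightarrow> j < N \<Longrightarrow> B i j \<in> carrier (poly_ring n)"
    and "\<And>i j. i < N \<Longrightarrow> j < N \<Longrightarrow> A i j - B i j \<in> I"
  shows "poly_det N A - poly_det N B \<in> I"
proof -
  have "of_int (sign p) * ((\<Prod>i<N. A i (p i)) - (\<Prod>i<N. B i (p i))) \<in> I" if "p permutes {..<N}" for p
  proof -
    have "(\<Prod>i<N. A i (p i)) - (\<Prod>i<N. B i (p i)) \<in> I"
      using permutes_in_image[OF that] by (intro prod_cong_mod assms) auto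
    moreover have "of_int (sign p) \<in> carrier (poly_ring n)" by (cases p rule: sign_cases) auto
    ultimately show ?thesis by (rule mult_in)
  qed
  then have "(\<Sum>p | p permutes {..<N}. of_int (sign p) * ((\<Prod>i<N. A i (p i)) - (\<Prod>i<N. B i (p i)))) \<in> I"
    by (intro sum_in) auto
  then show ?thesis by (simp add: poly_det_def right_diff_distrib sum_subtractf)
qed

end

section \<open>Homogeneous coordinate rings\<close>

context poly_ideal
begin

abbreviation "cls \<equiv> coord_class n I"
abbreviation "A \<equiv> coord_ring n I"

lemma cls_def': "cls F = {h + F | h. h \<in> I}"
  by (auto simp: coord_class_def a_r_coset_def')

lemma carrier_A: "carrier A = cls ` carrier (poly_ring n)"
  by (auto simp: coord_ring_def coord_class_def FactRing_def A_RCOSETS_def' a_r_coset_def')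

lemma cring_A: "cring A"
  unfolding coord_ring_def by (rule quotient_is_cring) (rule cring_poly_ring)

lemma cls_closed [simp, intro]: "F \<in> carrier (poly_ring n) \<Longrightarrow> cls F \<in> carrier A"
  by (auto simp: carrier_A)

lemma cls_eq_iff: "cls F = cls G \<longleftrightarrow> F - G \<in> I"
proof
  assume "cls F = cls G"
  moreover have "F \<in> cls F" by (force simp: cls_def')
  ultimately show "F - G \<in> I" by (auto simp: cls_def')
next
  assume FG: "F - G \<in> I"
  have "h + F \<in> cls G" if "h \<in> I" for h
    using add_in[OF that FG] by (force simp: cls_def' intro: exI[of _ "h + (F - G)"])
  moreover have "h + G \<in> cls F" if "h \<in> I" for h
    using minus_in[OF that FG] by (force simp: cls_def' intro: exI[of _ "h - (F - G)"])
  ultimately show "cls F = cls G" by (auto simp: cls_def')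
qed

lemma cls_simps:
  assumes "F \<in> carrier (poly_ring n)" "G \<in> carrier (poly_ring n)"
  shows "cls (F + G) = cls F \<oplus>\<^bsub>A\<^esub> cls G" "cls (F * G) = cls F \<otimes>\<^bsub>A\<^esub> cls G"
  using assms ring_hom_add[OF rcos_ring_hom, of F G] ring_hom_mult[OF rcos_ring_hom, of F G]
  by (simp_all add: coord_class_def coord_ring_def)

lemma cls_one: "cls 1 = \<one>\<^bsub>A\<^esub>"
  using ring_hom_one[OF rcos_ring_hom] by (simp add: coord_class_def coord_ring_def)

lemma cls_zero: "cls 0 = \<zero>\<^bsub>A\<^esub>"
  by (auto simp: cls_def' coord_ring_def FactRing_def)

end

text \<open>\<open>deriv_in\<close> and \<open>deriv_gen\<close> say together that Y is the ideal
  generated by the partial derivatives of W. The first lets the derivations descend to maps from S/W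
  to S/Y, which bounds the annihilator of dx_0 ^ ... ^ dx_n from above; the second bounds it from
  below.\<close>

locale poly_ideal_pair = W: poly_ideal n W + Y: poly_ideal n Y
  for n and W Y :: "'k::field_char_0 mpoly set" +
  assumes incl: "W \<subseteq> Y"
    and deriv_in: "\<And>F j. F \<in> W \<Longrightarrow> j \<le> n \<Longrightarrow> partial_deriv j F \<in> Y"
    and deriv_gen: "\<And>J F. ideal J (poly_ring n) \<Longrightarrow>
      (\<And>F j. F \<in> W \<Longrightarrow> j \<le> n \<Longrightarrow> partial_deriv j F \<in> J) \<Longrightarrow> F \<in> Y \<Longrightarrow> F \<in> J"
begin

abbreviation "S \<equiv> carrier (poly_ring n :: 'k mpoly ring)"
abbreviation "R \<equiv> coord_ring n W"
abbreviation "N \<equiv> coord_module n W Y"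
abbreviation "constants \<equiv> range (coord_scalar n W)"

lemma N_simps:
  "carrier N = carrier Y.A" "\<zero>\<^bsub>N\<^esub> = \<zero>\<^bsub>Y.A\<^esub>" "x \<oplus>\<^bsub>N\<^esub> y = x \<oplus>\<^bsub>Y.A\<^esub> y"
  by (simp_all add: coord_module_def restrict_scalars_def self_module_def)

text \<open>The scalar action adds Y to a coset of W. As W lies in Y, this gives the coset of Y with
  the same representative.\<close>

lemma N_smult:
  assumes "F \<in> S" "G \<in> S"
  shows "W.cls F \<odot>\<^bsub>N\<^esub> Y.cls G = Y.cls (F * G)"
proof -
  have "Y <+>\<^bsub>poly_ring n\<^esub> W.cls F = {a + (b + F) | a b. a \<in> Y \<and> b \<in> W}"
    by (auto simp: set_add_def' W.cls_def')
  also have "\<dots> = Y.cls F"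
  proof
    show "{a + (b + F) | a b. a \<in> Y \<and> b \<in> W} \<subseteq> Y.cls F"
      using incl Y.add_in by (force simp: Y.cls_def' simp flip: add.assoc)
    show "Y.cls F \<subseteq> {a + (b + F) | a b. a \<in> Y \<and> b \<in> W}"
      using W.zero_in by (force simp: Y.cls_def')
  qed
  finally show ?thesis
    using assms by (simp add: Y.cls_simps coord_module_def restrict_scalars_def self_module_def)
qed

lemma module_N: "module R N"
proof (rule moduleI)
  interpret A: cring Y.A by (rule Y.cring_A)
  show "abelian_group N"
    by (rule abelian_groupI) (auto simp: N_simps A.a_ac intro: A.l_neg)
qed (auto simp: N_simps W.cring_A W.carrier_A Y.carrier_A N_smult algebra_simps
    simp flip: W.cls_simps Y.cls_simps W.cls_one)

sublocale N: module R N by (rule module_N)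

lemma constants_closed: "constants \<subseteq> carrier R"
  by (auto simp: coord_scalar_def)

sublocale K: kaehler_module R constants
  by (intro kaehler_module.intro W.cring_A kaehler_module_axioms.intro constants_closed)

lemma module_omega1: "module R (omega1 n W)"
  unfolding omega1_def by (rule K.module_\<Omega>)

sublocale E: exterior_power R "omega1 n W" "Suc n"
  by (intro exterior_power.intro module_omega1)

abbreviation "d F \<equiv> kaehler_d R constants (W.cls F)"
abbreviation "dx \<equiv> omega1_dx n W"

lemma dx_eq: "dx j = d (poly_var j)"
  by (simp add: omega1_dx_def)

lemma d_closed: "F \<in> S \<Longrightarrow> d F \<in> carrier (omega1 n W)"
  using K.d_closed by (simp add: omega1_def)

lemma dx_closed: "j \<le> n \<Longrightarrow> dx j \<in> carrier (omega1 n W)"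
  by (simp add: dx_eq d_closed poly_var_closed)

text \<open>Both sides are derivations in F that vanish on constants and agree on the variables; the
  induction retraces this.\<close>

lemma d_expand:
  assumes "F \<in> S"
  shows "d F = (\<Oplus>\<^bsub>omega1 n W\<^esub>j\<in>{..n}. W.cls (partial_deriv j F) \<odot>\<^bsub>omega1 n W\<^esub> dx j)"
  using assms
proof (induction rule: poly_ring_induct)
  case (const c)
  have "d (poly_const c) = \<zero>\<^bsub>omega1 n W\<^esub>"
    unfolding omega1_def by (rule K.d_const) (simp add: coord_scalar_def)
  moreover have "(\<Oplus>\<^bsub>omega1 n W\<^esub>j\<in>{..n}. W.cls (partial_deriv j (poly_const c)) \<odot>\<^bsub>omega1 n W\<^esub> dx j)
      = \<zero>\<^bsub>omega1 n W\<^esub>"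
    by (rule E.E.M.add.finprod_one_eqI) (simp add: W.cls_zero dx_closed)
  ultimately show ?case by simp
next
  case (var i)
  have "(\<Oplus>\<^bsub>omega1 n W\<^esub>j\<in>{..n}. W.cls (partial_deriv j (poly_var i)) \<odot>\<^bsub>omega1 n W\<^esub> dx j)
      = (\<Oplus>\<^bsub>omega1 n W\<^esub>j\<in>{..n}. (if j = i then \<one>\<^bsub>R\<^esub> else \<zero>\<^bsub>R\<^esub>) \<odot>\<^bsub>omega1 n W\<^esub> dx j)"
    by (rule E.E.M.finsum_cong') (auto simp: partial_deriv_var W.cls_one W.cls_zero dx_closed)
  also have "\<dots> = dx i"
    by (rule E.E.finsum_smult_delta) (use var in \<open>auto simp: dx_closed\<close>)
  finally show ?case by (simp add: dx_eq)
next
  case (add G H)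
  have "d (G + H) = d G \<oplus>\<^bsub>omega1 n W\<^esub> d H"
    using add.hyps K.d_add[of "W.cls G" "W.cls H"] by (simp add: W.cls_simps omega1_def)
  also have "\<dots> = (\<Oplus>\<^bsub>omega1 n W\<^esub>j\<in>{..n}. W.cls (partial_deriv j G) \<odot>\<^bsub>omega1 n W\<^esub> dx j
      \<oplus>\<^bsub>omega1 n W\<^esub> W.cls (partial_deriv j H) \<odot>\<^bsub>omega1 n W\<^esub> dx j)"
    unfolding add.IH by (rule E.E.M.finsum_addf[symmetric]) (use add.hyps dx_closed in auto)
  also have "\<dots> = (\<Oplus>\<^bsub>omega1 n W\<^esub>j\<in>{..n}. W.cls (partial_deriv j (G + H)) \<odot>\<^bsub>omega1 n W\<^esub> dx j)"
    by (rule E.E.M.finsum_cong')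
      (use add.hyps dx_closed in \<open>auto simp: partial_deriv_add W.cls_simps E.E.smult_l_distr\<close>)
  finally show ?case .
next
  case (mult G H)
  have "d (G * H) = W.cls G \<odot>\<^bsub>omega1 n W\<^esub> d H \<oplus>\<^bsub>omega1 n W\<^esub> W.cls H \<odot>\<^bsub>omega1 n W\<^esub> d G"
    using mult.hyps K.d_mult[of "W.cls G" "W.cls H"] by (simp add: W.cls_simps omega1_def)
  also have "\<dots> = (\<Oplus>\<^bsub>omega1 n W\<^esub>j\<in>{..n}. W.cls G \<odot>\<^bsub>omega1 n W\<^esub> (W.cls (partial_deriv j H) \<odot>\<^bsub>omega1 n W\<^esub> dx j))
      \<oplus>\<^bsub>omega1 n W\<^esub> (\<Oplus>\<^bsub>omega1 n W\<^esub>j\<in>{..n}. W.cls H \<odot>\<^bsub>omega1 n W\<^esub> (W.cls (partial_deriv j G) \<odot>\<^bsub>omega1 n W\<^esub> dx j))"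
    unfolding mult.IH using mult.hyps dx_closed
    by (intro arg_cong2[where f = "(\<oplus>\<^bsub>omega1 n W\<^esub>)"] E.E.finsum_smult_ldistr) auto
  also have "\<dots> = (\<Oplus>\<^bsub>omega1 n W\<^esub>j\<in>{..n}. W.cls G \<odot>\<^bsub>omega1 n W\<^esub> (W.cls (partial_deriv j H) \<odot>\<^bsub>omega1 n W\<^esub> dx j)
      \<oplus>\<^bsub>omega1 n W\<^esub> W.cls H \<odot>\<^bsub>omega1 n W\<^esub> (W.cls (partial_deriv j G) \<odot>\<^bsub>omega1 n W\<^esub> dx j))"
    by (rule E.E.M.finsum_addf[symmetric]) (use mult.hyps dx_closed in auto)
  also have "\<dots> = (\<Oplus>\<^bsub>omega1 n W\<^esub>j\<in>{..n}. W.cls (partial_deriv j (G * H)) \<odot>\<^bsub>omega1 n W\<^esub> dx j)"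
    by (rule E.E.M.finsum_cong') (use mult.hyps dx_closed in
      \<open>auto simp: partial_deriv_mult W.cls_simps E.E.smult_l_distr E.E.smult_assoc1\<close>)
  finally show ?case .
qed

lemma omega1_generated:
  assumes H: "submodule H R (omega1 n W)" and dx: "\<And>j. j \<le> n \<Longrightarrow> dx j \<in> H"
  shows "carrier (omega1 n W) \<subseteq> H"
  unfolding omega1_def
proof (rule K.kaehler_generated)
  show "submodule H R (kaehler R constants)" using H by (simp add: omega1_def)
  fix a assume "a \<in> carrier R"
  then obtain F where "F \<in> S" "a = W.cls F" by (auto simp: W.carrier_A)
  then show "kaehler_d R constants a \<in> H"
    using E.E.submoduleE(4)[OF H] dx
    by (auto simp: d_expand intro!: E.E.submodule_finsum[OF H])
qed

subsection \<open>The module of top forms is cyclic\<close>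

abbreviation "L \<equiv> omega n W (Suc n)"

text \<open>The function f names the factors, so that permuted products and products with
  repetitions have a common form.\<close>

definition dx_list :: "(nat \<Rightarrow> nat) \<Rightarrow> ('k mpoly set \<Rightarrow> 'k mpoly set) set list" where
  "dx_list f = map (\<lambda>i. dx (f i)) [0..<Suc n]"

definition top_form :: "(('k mpoly set \<Rightarrow> 'k mpoly set) set list \<Rightarrow> 'k mpoly set) set" where
  "top_form = wedge R (omega1 n W) (dx_list id)"

lemma length_dx_list [simp]: "length (dx_list f) = Suc n"
  by (simp add: dx_list_def del: upt_Suc)

lemma nth_dx_list [simp]: "i \<le> n \<Longrightarrow> dx_list f ! i = dx (f i)"
  by (simp add: dx_list_def del: upt_Suc)

lemma L_eq: "L = E.\<Lambda>"
  by (simp add: omega_def)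

sublocale L: module R L
  unfolding L_eq by (rule E.module_\<Lambda>)

lemma dx_list_in_T: "(\<And>i. i \<le> n \<Longrightarrow> f i \<le> n) \<Longrightarrow> dx_list f \<in> E.T"
  by (auto simp: dx_list_def tuples_def dx_closed less_Suc_eq_le simp del: upt_Suc)

lemma top_form_closed: "top_form \<in> carrier L"
  unfolding L_eq top_form_def by (rule E.wedge_closed) (simp add: dx_list_in_T)

lemma cyclic_submodule: "submodule {r \<odot>\<^bsub>L\<^esub> top_form | r. r \<in> carrier R} R L"
proof (rule L.submoduleI)
  show "\<zero>\<^bsub>L\<^esub> \<in> {r \<odot>\<^bsub>L\<^esub> top_form | r. r \<in> carrier R}"
    using L.smult_l_null[OF top_form_closed] by force
  fix X assume "X \<in> {r \<odot>\<^bsub>L\<^esub> top_form | r. r \<in> carrier R}"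
  then obtain r where r: "r \<in> carrier R" "X = r \<odot>\<^bsub>L\<^esub> top_form" by blast
  show "\<ominus>\<^bsub>L\<^esub> X \<in> {r \<odot>\<^bsub>L\<^esub> top_form | r. r \<in> carrier R}"
    using r top_form_closed L.smult_l_minus[symmetric] by blast
  show "a \<odot>\<^bsub>L\<^esub> X \<in> {r \<odot>\<^bsub>L\<^esub> top_form | r. r \<in> carrier R}" if "a \<in> carrier R" for a
    using r that top_form_closed L.smult_assoc1[symmetric] by blast
  fix Z assume "Z \<in> {r \<odot>\<^bsub>L\<^esub> top_form | r. r \<in> carrier R}"
  then obtain q where q: "q \<in> carrier R" "Z = q \<odot>\<^bsub>L\<^esub> top_form" by blast
  then show "X \<oplus>\<^bsub>L\<^esub> Z \<in> {r \<odot>\<^bsub>L\<^esub> top_form | r. r \<in> carrier R}"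
    using r top_form_closed L.smult_l_distr[symmetric] by blast
qed (use top_form_closed in auto)

text \<open>A permutation is a product of transpositions, and each of them changes the sign.
  Membership in the cyclic submodule is all that is claimed, so the sign is not tracked.\<close>

lemma wedge_permuted_dx:
  assumes "p permutes {..n}"
  shows "wedge R (omega1 n W) (dx_list p) \<in> {r \<odot>\<^bsub>L\<^esub> top_form | r. r \<in> carrier R}"
  using finite_atMost assms
proof (induction rule: permutes_rev_induct)
  case id
  have "top_form = \<one>\<^bsub>R\<^esub> \<odot>\<^bsub>L\<^esub> top_form" using top_form_closed by simp
  then show ?case unfolding top_form_def[symmetric] by blast
next
  case (swap a b p)
  define xs where "xs = dx_list p"
  have p: "p i \<le> n" if "i \<le> n" for i using permutes_in_image[OF swap.hyps(4), of i] that by simp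
  have xs: "xs \<in> E.T" unfolding xs_def by (rule dx_list_in_T) (rule p)
  have "dx_list (p \<circ> transpose a b) = xs[a := dx (p b), b := dx (p a)]"
    using swap.hyps by (intro nth_equalityI) (auto simp: xs_def nth_list_update transpose_def less_Suc_eq_le)
  \<comment> \<open>Updating \<open>xs\<close> with its own entries brings it into the form required
    by \<open>wedge_swap\<close>.\<close>
  moreover have "xs = xs[a := dx (p a), b := dx (p b)]"
    using swap.hyps by (intro nth_equalityI) (auto simp: xs_def nth_list_update less_Suc_eq_le)
  moreover have "wedge R (omega1 n W) (xs[a := dx (p b), b := dx (p a)])
      = \<ominus>\<^bsub>L\<^esub> wedge R (omega1 n W) (xs[a := dx (p a), b := dx (p b)])"
    unfolding L_eq using swap.hyps xs p by (intro E.wedge_swap dx_closed) auto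
  ultimately have "wedge R (omega1 n W) (dx_list (p \<circ> transpose a b)) = \<ominus>\<^bsub>L\<^esub> wedge R (omega1 n W) xs"
    by metis
  then show ?case
    using L.submoduleE(3)[OF cyclic_submodule swap.IH] by (simp only: xs_def)
qed

text \<open>Entries are reduced to generators one place at a time. The wedge is linear in each
  place, so the entries that lead into the cyclic submodule form a submodule, and it suffices to
  insert the dx_j. Once all entries are of this kind, either two coincide or they are a permutation
  of dx_0, ..., dx_n.\<close>

lemma wedge_in_cyclic:
  assumes "xs \<in> E.T"
  shows "wedge R (omega1 n W) xs \<in> {r \<odot>\<^bsub>L\<^esub> top_form | r. r \<in> carrier R}" (is "_ \<in> ?C")
proof -
  \<comment> \<open>The first \<open>k\<close> entries are arbitrary and the others are among the \<open>dx j\<close>.\<close>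
  have "wedge R (omega1 n W) xs \<in> ?C"
    if "k \<le> Suc n" "xs \<in> E.T" "\<And>i. k \<le> i \<Longrightarrow> i \<le> n \<Longrightarrow> xs ! i \<in> dx ` {..n}" for k xs
    using that
  proof (induction k arbitrary: xs)
    case 0
    then have "\<forall>i\<in>{..n}. \<exists>j. j \<le> n \<and> xs ! i = dx j" by auto
    then obtain f where f: "\<And>i. i \<le> n \<Longrightarrow> f i \<le> n \<and> xs ! i = dx (f i)"
      by (metis atMost_iff)
    have len: "length xs = Suc n" using 0 by (simp add: tuples_def)
    show ?case
    proof (cases "inj_on f {..n}")
      case True
      \<comment> \<open>\<open>permutes\<close> requires the identity outside the index set, so f is
        extended by it.\<close>
      define p where "p i = (if i \<le> n then f i else i)" for i
      have inj: "inj_on p {..n}" using True by (auto simp: inj_on_def p_def)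
      moreover have "p ` {..n} \<subseteq> {..n}" using f by (auto simp: p_def)
      ultimately have "bij_betw p {..n} {..n}"
        by (auto simp: bij_betw_def endo_inj_surj)
      then have "p permutes {..n}" by (rule bij_imp_permutes) (simp add: p_def)
      moreover have "xs = dx_list p"
        by (rule nth_equalityI) (use f len in \<open>auto simp: p_def less_Suc_eq_le\<close>)
      ultimately show ?thesis using wedge_permuted_dx by simp
    next
      case False
      then obtain i j where "i \<le> n" "j \<le> n" "i \<noteq> j" "f i = f j" by (auto simp: inj_on_def)
      then have "wedge R (omega1 n W) xs = \<zero>\<^bsub>L\<^esub>"
        unfolding L_eq using f 0 by (intro E.wedge_repeated[of _ i j]) auto
      then show ?thesis using L.submodule_zero[OF cyclic_submodule] by simp
    qed
  next
    case (Suc k)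
    then have k: "k < Suc n" by simp
    interpret h: module_hom R "omega1 n W" L "\<lambda>x. wedge R (omega1 n W) (xs[k := x])"
      unfolding L_eq
      by (intro module_homI module_omega1 E.module_\<Lambda> E.wedge_hom Suc.prems k)
    have "carrier (omega1 n W) \<subseteq> {x \<in> carrier (omega1 n W). wedge R (omega1 n W) (xs[k := x]) \<in> ?C}"
    proof (rule omega1_generated[OF h.vimage_submodule[OF cyclic_submodule]])
      fix j assume j: "j \<le> n"
      have "wedge R (omega1 n W) (xs[k := dx j]) \<in> ?C"
        using Suc.prems k j
        by (intro Suc.IH E.update_in_T dx_closed) (auto simp: nth_list_update tuples_def Suc_le_eq)
      then show "dx j \<in> {x \<in> carrier (omega1 n W). wedge R (omega1 n W) (xs[k := x]) \<in> ?C}"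
        using dx_closed[OF j] by simp
    qed
    moreover have "xs ! k \<in> carrier (omega1 n W)" using E.nth_closed Suc.prems k by simp
    ultimately have "wedge R (omega1 n W) (xs[k := xs ! k]) \<in> ?C" by blast
    then show ?case by simp
  qed
  from this[of "Suc n" xs] assms show ?thesis by simp
qed

lemma L_cyclic:
  assumes "X \<in> carrier L"
  obtains F where "F \<in> S" "X = W.cls F \<odot>\<^bsub>L\<^esub> top_form"
proof -
  have "carrier L \<subseteq> {r \<odot>\<^bsub>L\<^esub> top_form | r. r \<in> carrier R}"
    using cyclic_submodule wedge_in_cyclic unfolding L_eq by (intro E.ext_power_generated)
  then show thesis using assms that by (auto simp: W.carrier_A)
qed

lemma deriv_annihilates:
  assumes "F \<in> W" "k \<le> n"
  shows "W.cls (partial_deriv k F) \<odot>\<^bsub>L\<^esub> top_form = \<zero>\<^bsub>L\<^esub>"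
proof -
  let ?xs = "dx_list id"
  have xs: "?xs \<in> E.T" by (simp add: dx_list_in_T)
  have F: "F \<in> S" using W.closed_carrier assms(1) .
  interpret h: module_hom R "omega1 n W" L "\<lambda>x. wedge R (omega1 n W) (?xs[k := x])"
    unfolding L_eq using assms(2)
    by (intro module_homI module_omega1 E.module_\<Lambda> E.wedge_hom xs) auto
  have upd: "wedge R (omega1 n W) (?xs[k := dx j]) = (if j = k then top_form else \<zero>\<^bsub>L\<^esub>)"
    if j: "j \<le> n" for j
  proof (cases "j = k")
    case True
    then have "?xs[k := dx j] = ?xs"
      using assms(2) by (intro nth_equalityI) (auto simp: nth_list_update less_Suc_eq_le)
    then show ?thesis using True by (simp add: top_form_def)
  next
    case False
    \<comment> \<open>The factor dx_j now stands in places k and j.\<close>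
    have "wedge R (omega1 n W) (?xs[k := dx j]) = \<zero>\<^bsub>L\<^esub>"
      unfolding L_eq by (rule E.wedge_repeated[of _ k j])
        (use False j assms(2) xs in \<open>auto intro: E.update_in_T dx_closed\<close>)
    then show ?thesis using False by simp
  qed
  \<comment> \<open>In S/W the class of F is that of the constant 0, so dF = 0 is an instance of the
    relation for constants.\<close>
  have "W.cls F = W.cls 0" using assms(1) by (simp add: W.cls_eq_iff)
  moreover have "W.cls 0 \<in> constants"
    by (rule range_eqI[of _ _ 0]) (simp add: coord_scalar_def poly_const_simps)
  ultimately have "d F = \<zero>\<^bsub>omega1 n W\<^esub>"
    using K.d_const by (simp add: omega1_def)
  then have "\<zero>\<^bsub>L\<^esub> = wedge R (omega1 n W) (?xs[k := d F])"
    using h.hom_zero by simp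
  also have "\<dots> = (\<Oplus>\<^bsub>L\<^esub>j\<in>{..n}. wedge R (omega1 n W) (?xs[k := W.cls (partial_deriv j F) \<odot>\<^bsub>omega1 n W\<^esub> dx j]))"
    unfolding d_expand[OF F] by (rule h.finsum) (use F dx_closed in auto)
  also have "\<dots> = (\<Oplus>\<^bsub>L\<^esub>j\<in>{..n}. W.cls (partial_deriv j F) \<odot>\<^bsub>L\<^esub> wedge R (omega1 n W) (?xs[k := dx j]))"
    by (rule L.M.finsum_cong') (use F dx_closed h.closed in \<open>auto simp: h.smult\<close>)
  also have "\<dots> = (\<Oplus>\<^bsub>L\<^esub>j\<in>{..n}. if k = j then W.cls (partial_deriv j F) \<odot>\<^bsub>L\<^esub> top_form else \<zero>\<^bsub>L\<^esub>)"
    by (rule L.M.finsum_cong') (use F in \<open>auto simp: upd top_form_closed\<close>)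
  also have "\<dots> = W.cls (partial_deriv k F) \<odot>\<^bsub>L\<^esub> top_form"
    by (rule L.M.finsum_singleton) (use F assms(2) top_form_closed in auto)
  finally show ?thesis by simp
qed

text \<open>The polynomials that kill the top form are an ideal. By \<open>deriv_gen\<close> it
  contains Y as soon as it contains the derivatives of W.\<close>

lemma annihilator:
  assumes "F \<in> Y"
  shows "W.cls F \<odot>\<^bsub>L\<^esub> top_form = \<zero>\<^bsub>L\<^esub>"
proof -
  let ?J = "{F \<in> S. W.cls F \<odot>\<^bsub>L\<^esub> top_form = \<zero>\<^bsub>L\<^esub>}"
  note closed = top_form_closed
  have "ideal ?J (poly_ring n)"
  proof (rule idealI)
    show "ring (poly_ring n :: 'k mpoly ring)" ..
    have "W.cls (- F) \<odot>\<^bsub>L\<^esub> top_form = \<zero>\<^bsub>L\<^esub>"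
      if "F \<in> S" "W.cls F \<odot>\<^bsub>L\<^esub> top_form = \<zero>\<^bsub>L\<^esub>" for F
      using that closed W.cls_simps(2)[of "-1" F] L.smult_assoc1[of "W.cls (- 1)" "W.cls F" top_form]
      by simp
    moreover have "0 \<in> ?J" using closed by (simp add: W.cls_zero)
    moreover have "F + G \<in> ?J" if "F \<in> ?J" "G \<in> ?J" for F G
      using that closed by (simp add: W.cls_simps L.smult_l_distr)
    ultimately show "subgroup ?J (add_monoid (poly_ring n))"
      by (intro poly_ring.add.subgroupI) (auto simp: a_inv_def[symmetric])
    fix F G assume FG: "F \<in> ?J" "G \<in> S"
    have "W.cls (G * F) \<odot>\<^bsub>L\<^esub> top_form = \<zero>\<^bsub>L\<^esub>"
      using FG closed by (simp add: W.cls_simps L.smult_assoc1)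
    then show "G \<otimes>\<^bsub>poly_ring n\<^esub> F \<in> ?J" "F \<otimes>\<^bsub>poly_ring n\<^esub> G \<in> ?J"
      using FG by (simp_all add: mult.commute[of F G])
  qed
  moreover have "partial_deriv j F \<in> ?J" if "F \<in> W" "j \<le> n" for F j
    using deriv_annihilates that W.closed_carrier by auto
  ultimately have "F \<in> ?J" using deriv_gen assms by blast
  then show ?thesis by simp
qed

end

context poly_ideal_pair
begin

subsection \<open>Evaluating top forms\<close>

text \<open>This is d/dX_j as a derivation from S/W to S/Y. Two representatives of a class differ by
  an element of W, whose derivative vanishes in S/Y.\<close>

lemma derivation_form:
  assumes j: "j \<le> n"
  obtains \<delta> where "\<delta> \<in> mod_hom R (omega1 n W) N" "\<And>F. F \<in> S \<Longrightarrow> \<delta> (d F) = Y.cls (partial_deriv j F)"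
proof -
  define D where "D X = Y.cls (partial_deriv j (SOME F. F \<in> S \<and> W.cls F = X))" for X
  have D: "D (W.cls F) = Y.cls (partial_deriv j F)" if F: "F \<in> S" for F
  proof -
    define G where "G = (SOME G. G \<in> S \<and> W.cls G = W.cls F)"
    have "G \<in> S" "W.cls G = W.cls F"
      using someI[of "\<lambda>G. G \<in> S \<and> W.cls G = W.cls F" F] F by (auto simp: G_def)
    then have "partial_deriv j (G - F) \<in> Y" using deriv_in j by (simp add: W.cls_eq_iff)
    then show ?thesis by (simp add: D_def G_def[symmetric] Y.cls_eq_iff partial_deriv_minus)
  qed
  have "\<exists>h. h \<in> mod_hom R (kaehler R constants) N \<and> (\<forall>a\<in>carrier R. h (kaehler_d R constants a) = D a)"
  proof (rule K.derivation_lift[OF module_N])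
    fix a b assume "a \<in> carrier R" "b \<in> carrier R"
    then obtain F G where "F \<in> S" "G \<in> S" "a = W.cls F" "b = W.cls G" by (auto simp: W.carrier_A)
    then show "D a \<in> carrier N" "D (a \<oplus>\<^bsub>R\<^esub> b) = D a \<oplus>\<^bsub>N\<^esub> D b"
      "D (a \<otimes>\<^bsub>R\<^esub> b) = a \<odot>\<^bsub>N\<^esub> D b \<oplus>\<^bsub>N\<^esub> b \<odot>\<^bsub>N\<^esub> D a"
      by (simp_all add: D N_simps N_smult partial_deriv_add partial_deriv_mult
          flip: W.cls_simps Y.cls_simps)
  next
    fix a assume "a \<in> constants"
    then obtain c where "a = W.cls (poly_const c)" by (auto simp: coord_scalar_def)
    then show "D a = \<zero>\<^bsub>N\<^esub>" by (simp add: D N_simps Y.cls_zero)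
  qed (blast intro: that)+
  then obtain h where "h \<in> mod_hom R (omega1 n W) N" "\<And>a. a \<in> carrier R \<Longrightarrow> h (kaehler_d R constants a) = D a"
    unfolding omega1_def by blast
  then show thesis using D by (intro that[of h]) auto
qed

text \<open>The form dual to dx_j, with values in S/Y. The dF generate the differentials, so the
  chosen map is determined on the carrier.\<close>

definition coeff_form :: "nat \<Rightarrow> ('k mpoly set \<Rightarrow> 'k mpoly set) set \<Rightarrow> 'k mpoly set" where
  "coeff_form j = (SOME \<delta>. \<delta> \<in> mod_hom R (omega1 n W) N
     \<and> (\<forall>F\<in>S. \<delta> (d F) = Y.cls (partial_deriv j F)))"

lemma coeff_form:
  assumes "j \<le> n"
  shows "coeff_form j \<in> mod_hom R (omega1 n W) N"
    and "F \<in> S \<Longrightarrow> coeff_form j (d F) = Y.cls (partial_deriv j F)"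
proof -
  from derivation_form[OF assms] have
    "\<exists>\<delta>. \<delta> \<in> mod_hom R (omega1 n W) N \<and> (\<forall>F\<in>S. \<delta> (d F) = Y.cls (partial_deriv j F))" by metis
  from someI_ex[OF this] show "coeff_form j \<in> mod_hom R (omega1 n W) N"
    "F \<in> S \<Longrightarrow> coeff_form j (d F) = Y.cls (partial_deriv j F)"
    by (auto simp: coeff_form_def)
qed

lemma coeff_form_loc: "j \<le> n \<Longrightarrow> module_hom R (omega1 n W) N (coeff_form j)"
  by (intro module_homI module_omega1 module_N coeff_form)

lemma coeff_form_closed:
  "j \<le> n \<Longrightarrow> \<omega> \<in> carrier (omega1 n W) \<Longrightarrow> coeff_form j \<omega> \<in> carrier Y.A"
  using module_hom.closed[OF coeff_form_loc] by (simp add: N_simps)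

lemma coeff_form_dx: "j \<le> n \<Longrightarrow> i \<le> n \<Longrightarrow> coeff_form j (dx i) = Y.cls (if i = j then 1 else 0)"
  by (simp add: dx_eq coeff_form(2) poly_var_closed partial_deriv_var)

definition rep :: "'k mpoly set \<Rightarrow> 'k mpoly" where
  "rep X = (SOME F. F \<in> S \<and> Y.cls F = X)"

lemma rep: "X \<in> carrier Y.A \<Longrightarrow> rep X \<in> S" "X \<in> carrier Y.A \<Longrightarrow> Y.cls (rep X) = X"
  using someI_ex[of "\<lambda>F. F \<in> S \<and> Y.cls F = X"] by (auto simp: Y.carrier_A rep_def)

text \<open>The determinant over \<open>S/Y\<close> is computed on representatives in \<open>S\<close>, where the multiplication is
  that of a type.\<close>

definition det_form :: "('k mpoly set \<Rightarrow> 'k mpoly set) set list \<Rightarrow> 'k mpoly set" where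
  "det_form xs = Y.cls (poly_det (Suc n) (\<lambda>i j. rep (coeff_form j (xs ! i))))"

lemma rep_coeff_form:
  assumes "xs \<in> E.T" "i < Suc n" "j < Suc n"
  shows "rep (coeff_form j (xs ! i)) \<in> S"
    and "Y.cls (rep (coeff_form j (xs ! i))) = coeff_form j (xs ! i)"
  using assms E.nth_closed by (simp_all add: rep coeff_form_closed)

text \<open>Any representatives of the coefficients compute \<open>det_form\<close>. Each proof
  below picks those that suit it: sums or multiples within a row, the unit matrix, homogeneous
  polynomials.\<close>

lemma det_form_eqI:
  assumes xs: "xs \<in> E.T"
    and B: "\<And>i j. i \<le> n \<Longrightarrow> j \<le> n \<Longrightarrow> B i j \<in> S" "\<And>i j. i \<le> n \<Longrightarrow> j \<le> n \<Longrightarrow> Y.cls (B i j) = coeff_form j (xs ! i)"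
  shows "det_form xs = Y.cls (poly_det (Suc n) B)"
  unfolding det_form_def Y.cls_eq_iff
  by (rule Y.poly_det_cong_mod) (use rep_coeff_form[OF xs] B in \<open>auto simp flip: Y.cls_eq_iff\<close>)

lemma poly_det_rep_closed:
  "xs \<in> E.T \<Longrightarrow> poly_det (Suc n) (\<lambda>i j. rep (coeff_form j (xs ! i))) \<in> S"
  by (rule poly_det_closed) (rule rep_coeff_form)

lemma length_T: "xs \<in> E.T \<Longrightarrow> length xs = Suc n"
  by (simp add: tuples_def)

lemma top_form_hom:
  obtains h where "h \<in> mod_hom R L N" "\<And>xs. xs \<in> E.T \<Longrightarrow> h (wedge R (omega1 n W) xs) = det_form xs"
proof -
  have "\<exists>h. h \<in> mod_hom R E.\<Lambda> N \<and> (\<forall>xs\<in>E.T. h (wedge R (omega1 n W) xs) = det_form xs)"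
  proof (rule E.alternating_lift[OF module_N])
    fix xs assume "xs \<in> E.T"
    then show "det_form xs \<in> carrier N"
      by (simp add: det_form_def N_simps poly_det_rep_closed Y.cls_closed)
  next
    fix xs i x y assume a: "xs \<in> E.T" "i < Suc n" "x \<in> carrier (omega1 n W)" "y \<in> carrier (omega1 n W)"
    let ?B = "\<lambda>k j. rep (coeff_form j (xs[i := x] ! k))" and ?C = "\<lambda>k j. rep (coeff_form j (xs[i := y] ! k))"
    \<comment> \<open>\<open>rep\<close> is not additive. The sum of the representatives for x and y
      is another representative of the same class, and for it the determinant splits
      literally.\<close>
    let ?A = "\<lambda>k j. if k = i then ?B k j + ?C k j else ?B k j"
    note T = E.update_in_T[OF a(1,3), of i] E.update_in_T[OF a(1,4), of i]
      E.update_in_T[OF a(1), of "x \<oplus>\<^bsub>omega1 n W\<^esub> y" i]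
    note rep_B = rep_coeff_form[OF T(1)] and rep_C = rep_coeff_form[OF T(2)]
    have "det_form (xs[i := x \<oplus>\<^bsub>omega1 n W\<^esub> y]) = Y.cls (poly_det (Suc n) ?A)"
    proof (rule det_form_eqI)
      fix k j assume kj: "k \<le> n" "j \<le> n"
      show "?A k j \<in> S" using rep_B[of k j] rep_C[of k j] kj by auto
      show "Y.cls (?A k j) = coeff_form j (xs[i := x \<oplus>\<^bsub>omega1 n W\<^esub> y] ! k)"
        using rep_B[of k j] rep_C[of k j] kj a length_T[OF a(1)] module_hom.add[OF coeff_form_loc[of j]]
        by (auto simp: Y.cls_simps N_simps)
    qed (use T(3) a in auto)
    also have "poly_det (Suc n) ?A = poly_det (Suc n) ?B + poly_det (Suc n) ?C"
      by (rule poly_det_row_add[OF a(2)]) (auto simp: length_T[OF a(1)])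
    finally show "det_form (xs[i := x \<oplus>\<^bsub>omega1 n W\<^esub> y]) = det_form (xs[i := x]) \<oplus>\<^bsub>N\<^esub> det_form (xs[i := y])"
      using T by (simp add: det_form_def Y.cls_simps N_simps poly_det_rep_closed)
  next
    fix xs i r x assume a: "xs \<in> E.T" "i < Suc n" "r \<in> carrier R" "x \<in> carrier (omega1 n W)"
    then obtain F where F: "F \<in> S" "r = W.cls F" by (auto simp: W.carrier_A)
    let ?B = "\<lambda>k j. rep (coeff_form j (xs[i := x] ! k))"
    let ?A = "\<lambda>k j. if k = i then F * ?B k j else ?B k j"
    note T = E.update_in_T[OF a(1,4), of i] E.update_in_T[OF a(1), of "r \<odot>\<^bsub>omega1 n W\<^esub> x" i]
    note rep_B = rep_coeff_form[OF T(1)]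
    have "det_form (xs[i := r \<odot>\<^bsub>omega1 n W\<^esub> x]) = Y.cls (poly_det (Suc n) ?A)"
    proof (rule det_form_eqI)
      fix k j assume kj: "k \<le> n" "j \<le> n"
      show "?A k j \<in> S" using rep_B[of k j] kj F by auto
      show "Y.cls (?A k j) = coeff_form j (xs[i := r \<odot>\<^bsub>omega1 n W\<^esub> x] ! k)"
        using rep_B[of k j] kj a length_T[OF a(1)] module_hom.smult[OF coeff_form_loc[of j], of r x]
          N_smult[OF F(1), of "?B k j"] F(2)
        by (auto simp: nth_list_update)
    qed (use T(2) a in auto)
    also have "poly_det (Suc n) ?A = F * poly_det (Suc n) ?B"
      by (rule poly_det_row_mult[OF a(2)]) auto
    finally show "det_form (xs[i := r \<odot>\<^bsub>omega1 n W\<^esub> x]) = r \<odot>\<^bsub>N\<^esub> det_form (xs[i := x])"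
      using F T by (simp add: det_form_def N_smult poly_det_rep_closed)
  next
    fix xs i j assume "xs \<in> E.T" "i < j" "j < Suc n" "xs ! i = xs ! j"
    then have "poly_det (Suc n) (\<lambda>i j. rep (coeff_form j (xs ! i))) = 0"
      by (intro poly_det_identical_rows[of i _ j]) auto
    then show "det_form xs = \<zero>\<^bsub>N\<^esub>" by (simp add: det_form_def Y.cls_zero N_simps)
  qed (blast intro: that)+
  then show thesis using that by (auto simp: L_eq)
qed

lemma det_form_dx: "det_form (dx_list id) = Y.cls 1"
proof -
  have "det_form (dx_list id) = Y.cls (poly_det (Suc n) (\<lambda>i j. if i = j then 1 else 0))"
    by (rule det_form_eqI) (auto simp: dx_list_in_T coeff_form_dx)
  then show ?thesis by (simp add: poly_det_one)
qed

section \<open>Degrees of top forms and Hilbert functions\<close>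

lemma coord_grade_subgroup: "subgroup (coord_grade n Y i) (add_monoid N)"
proof (rule N.add.subgroupI)
  show "coord_grade n Y i \<subseteq> carrier N"
    by (auto simp: coord_grade_def N_simps homog_part_closed)
  show "coord_grade n Y i \<noteq> {}" using homog_part_zero unfolding coord_grade_def by blast
  fix X assume "X \<in> coord_grade n Y i"
  then obtain F where F: "F \<in> homog_part n i" "X = Y.cls F" by (auto simp: coord_grade_def)
  have "\<ominus>\<^bsub>N\<^esub> X = Y.cls (- F)"
    using F homog_part_closed[OF F(1)]
    by (intro N.minus_equality) (auto simp: N_simps Y.cls_zero simp flip: Y.cls_simps)
  then show "\<ominus>\<^bsub>N\<^esub> X \<in> coord_grade n Y i"
    using homog_part_uminus[OF F(1)] by (auto simp: coord_grade_def)
  fix Z assume "Z \<in> coord_grade n Y i"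
  then obtain G where G: "G \<in> homog_part n i" "Z = Y.cls G" by (auto simp: coord_grade_def)
  have "X \<oplus>\<^bsub>N\<^esub> Z = Y.cls (F + G)"
    using F G homog_part_closed[OF F(1)] homog_part_closed[OF G(1)] by (simp add: N_simps Y.cls_simps)
  then show "X \<oplus>\<^bsub>N\<^esub> Z \<in> coord_grade n Y i"
    using homog_part_add[OF F(1) G(1)] by (auto simp: coord_grade_def)
qed

lemma omega1_grade_gens:
  "{r \<odot>\<^bsub>omega1 n W\<^esub> dx j | r j. r \<in> coord_grade n W (i - 1) \<and> j \<le> n} \<subseteq> carrier (omega1 n W)"
  by (auto simp: coord_grade_def intro!: E.E.smult_closed W.cls_closed dx_closed intro: homog_part_closed)

lemma omega1_grade_closed: "omega1_grade n W i \<subseteq> carrier (omega1 n W)"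
  unfolding omega1_grade_def
  using E.E.M.add.generate_incl[of "{r \<odot>\<^bsub>omega1 n W\<^esub> dx j | r j. r \<in> coord_grade n W (i - 1) \<and> j \<le> n}"]
    omega1_grade_gens by simp

text \<open>As dx_k has degree 1, the coefficients of a form have degree one less than the
  form.\<close>

lemma coeff_form_grade:
  assumes "j \<le> n" "\<omega> \<in> omega1_grade n W i"
  shows "coeff_form j \<omega> \<in> coord_grade n Y (i - 1)"
proof -
  interpret h: module_hom R "omega1 n W" N "coeff_form j" by (rule coeff_form_loc) fact
  have "coeff_form j ` omega1_grade n W i \<subseteq> coord_grade n Y (i - 1)"
    unfolding omega1_grade_def
  proof (rule h.generate_image[OF omega1_grade_gens coord_grade_subgroup], clarify)
    fix r k assume "r \<in> coord_grade n W (i - 1)" "k \<le> n"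
    then obtain F where F: "F \<in> homog_part n (i - 1)" "r = W.cls F" by (auto simp: coord_grade_def)
    have "coeff_form j (r \<odot>\<^bsub>omega1 n W\<^esub> dx k) = Y.cls (F * (if k = j then 1 else 0))"
      using F homog_part_closed[OF F(1)] \<open>k \<le> n\<close> assms(1)
      by (simp add: h.smult dx_closed coeff_form_dx N_smult)
    then show "coeff_form j (r \<odot>\<^bsub>omega1 n W\<^esub> dx k) \<in> coord_grade n Y (i - 1)"
      using F(1) by (auto simp: coord_grade_def)
  qed
  then show ?thesis using assms(2) by blast
qed

text \<open>Each of the n + 1 rows of the coefficient matrix loses one degree; this is the origin of
  the shift by n + 1.\<close>

lemma omega_grade_gens:
  assumes "length xs = Suc n" "length ds = Suc n" "\<forall>k<Suc n. xs ! k \<in> omega1_grade n W (ds ! k)"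
  shows "xs \<in> E.T" and "det_form xs \<in> coord_grade n Y (sum_list ds - int n - 1)"
proof -
  show xs: "xs \<in> E.T"
    using assms omega1_grade_closed by (fastforce simp: tuples_def in_set_conv_nth)
  \<comment> \<open>Homogeneous representatives. The bounds stand below the quantifier so that the
    choice becomes a total function of i and j.\<close>
  have "\<forall>i j. \<exists>F. i \<le> n \<longrightarrow> j \<le> n \<longrightarrow> F \<in> homog_part n (ds ! i - 1) \<and> Y.cls F = coeff_form j (xs ! i)"
    using coeff_form_grade assms(3) by (fastforce simp: coord_grade_def less_Suc_eq_le)
  then obtain B where B: "\<And>i j. i \<le> n \<Longrightarrow> j \<le> n \<Longrightarrow> B i j \<in> homog_part n (ds ! i - 1) \<and> Y.cls (B i j) = coeff_form j (xs ! i)"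
    by metis
  have "det_form xs = Y.cls (poly_det (Suc n) B)"
    by (rule det_form_eqI[OF xs]) (use B[THEN conjunct1, THEN homog_part_closed] B in auto)
  moreover have "poly_det (Suc n) B \<in> homog_part n (\<Sum>i<Suc n. ds ! i - 1)"
    by (rule poly_det_homog) (use B in auto)
  moreover have "(\<Sum>i<Suc n. ds ! i - 1) = sum_list ds - int n - 1"
    using assms(2) by (simp add: sum_subtractf sum_list_sum_nth atLeast0LessThan del: sum.lessThan_Suc)
  ultimately show "det_form xs \<in> coord_grade n Y (sum_list ds - int n - 1)"
    unfolding coord_grade_def by (metis image_eqI)
qed

lemma omega_grade_closed: "omega_grade n W (Suc n) i \<subseteq> carrier L"
  unfolding omega_grade_def ext_grade_def L_eq
  by (rule E.L.M.add.generate_incl[simplified]) (use omega_grade_gens(1) E.wedge_closed in auto)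

text \<open>Every top form is F w with w = \<open>top_form\<close>, and h sends it to F mod Y. So h
  is onto; and if F w and G w have the same image, then F - G lies in Y and annihilates w.\<close>

theorem top_forms_graded_iso:
  "graded_module_iso R L (omega_grade n W (Suc n)) N (grade_shift (coord_grade n Y) (- int n - 1))"
  and hilbert_function_top_forms:
  "hilbert_function (coord_scalar n W) L (omega_grade n W (Suc n)) i =
    hilbert_function (coord_scalar n Y) (self_module (coord_ring n Y)) (coord_grade n Y) (i - int n - 1)"
proof -
  obtain h where h: "h \<in> mod_hom R L N" "\<And>xs. xs \<in> E.T \<Longrightarrow> h (wedge R (omega1 n W) xs) = det_form xs"
    using top_form_hom by blast
  interpret h: module_hom R L N h by (intro module_homI L.module_axioms module_N h(1))
  have top: "h top_form = Y.cls 1"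
    using h(2) by (simp add: top_form_def dx_list_in_T det_form_dx)
  have h_top: "h (W.cls F \<odot>\<^bsub>L\<^esub> top_form) = Y.cls F" if "F \<in> S" for F
    using that by (simp add: h.smult top_form_closed top N_smult)
  have bij: "bij_betw h (carrier L) (carrier N)"
  proof (rule bij_betw_imageI)
    show "inj_on h (carrier L)"
    proof (rule inj_onI)
      fix X Z assume "X \<in> carrier L" "Z \<in> carrier L" and eq: "h X = h Z"
      then obtain F G where FG: "F \<in> S" "G \<in> S" and XZ: "X = W.cls F \<odot>\<^bsub>L\<^esub> top_form" "Z = W.cls G \<odot>\<^bsub>L\<^esub> top_form"
        using L_cyclic by metis
      then have "W.cls (F - G) \<odot>\<^bsub>L\<^esub> top_form = \<zero>\<^bsub>L\<^esub>"
        using annihilator eq by (simp add: h_top Y.cls_eq_iff)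
      moreover have "W.cls F \<odot>\<^bsub>L\<^esub> top_form = W.cls (F - G) \<odot>\<^bsub>L\<^esub> top_form \<oplus>\<^bsub>L\<^esub> W.cls G \<odot>\<^bsub>L\<^esub> top_form"
        using FG W.cls_simps(1)[of "F - G" G] by (simp add: top_form_closed flip: L.smult_l_distr)
      ultimately show "X = Z" using FG XZ top_form_closed by simp
    qed
    show "h ` carrier L = carrier N"
    proof
      show "carrier N \<subseteq> h ` carrier L"
        using top_form_closed by (auto simp: N_simps Y.carrier_A simp flip: h_top)
    qed auto
  qed
  have grade: "h ` omega_grade n W (Suc n) i = coord_grade n Y (i - int n - 1)" for i
  proof
    show "h ` omega_grade n W (Suc n) i \<subseteq> coord_grade n Y (i - int n - 1)"
      unfolding omega_grade_def ext_grade_def omega_def[symmetric]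
      by (rule h.generate_image[OF _ coord_grade_subgroup])
        (use omega_grade_gens E.wedge_closed in \<open>auto simp: h(2) L_eq\<close>)
    show "coord_grade n Y (i - int n - 1) \<subseteq> h ` omega_grade n W (Suc n) i"
    proof
      fix X assume "X \<in> coord_grade n Y (i - int n - 1)"
      then obtain F where F: "F \<in> homog_part n (i - int n - 1)" "X = Y.cls F" by (auto simp: coord_grade_def)
      have FS: "F \<in> S" using F(1) by (rule homog_part_closed)
      have gen: "r \<odot>\<^bsub>omega1 n W\<^esub> dx j \<in> omega1_grade n W e" if "r \<in> coord_grade n W (e - 1)" "j \<le> n" for r e j
        unfolding omega1_grade_def by (rule generate.incl) (use that in auto)
      \<comment> \<open>F mod Y is the image of F dx_0 ^ dx_1 ^ ... ^ dx_n. With F put into the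
        first factor, this factor has degree i - n and the other n have degree 1, so that the sum is
        i.\<close>
      let ?xs = "(dx_list id)[0 := W.cls F \<odot>\<^bsub>omega1 n W\<^esub> dx 0]"
      let ?ds = "(i - int n) # replicate n 1"
      have one: "dx j \<in> omega1_grade n W 1" if "j \<le> n" for j
      proof -
        have "\<one>\<^bsub>R\<^esub> \<in> coord_grade n W 0"
          unfolding W.cls_one[symmetric] coord_grade_def using homog_part_one by blast
        then show ?thesis using gen[of "\<one>\<^bsub>R\<^esub>" 1 j] that by (simp add: dx_closed)
      qed
      have "?xs ! k \<in> omega1_grade n W (?ds ! k)" if "k < Suc n" for k
      proof (cases k)
        case 0
        have "W.cls F \<in> coord_grade n W (i - int n - 1)" using F(1) by (auto simp: coord_grade_def)
        then show ?thesis using 0 gen by simp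
      next
        case (Suc l)
        then show ?thesis using that one[of k] by simp
      qed
      then have "wedge R (omega1 n W) ?xs \<in> omega_grade n W (Suc n) i"
        unfolding omega_grade_def ext_grade_def
        by (intro generate.incl) (auto intro!: exI[of _ ?xs] exI[of _ ?ds] simp: sum_list_replicate)
      moreover have "wedge R (omega1 n W) ?xs = W.cls F \<odot>\<^bsub>L\<^esub> top_form"
      proof -
        have "(dx_list id)[0 := dx 0] = dx_list id"
          by (rule nth_equalityI) (auto simp: nth_list_update less_Suc_eq_le)
        then show ?thesis
          using E.wedge_smult[of "dx_list id" 0 "dx 0" "W.cls F"] FS
          by (simp add: dx_list_in_T dx_closed L_eq top_form_def)
      qed
      ultimately show "X \<in> h ` omega_grade n W (Suc n) i"
        using h_top[OF FS] F(2) by (metis image_eqI)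
    qed
  qed
  show "graded_module_iso R L (omega_grade n W (Suc n)) N (grade_shift (coord_grade n Y) (- int n - 1))"
    unfolding graded_module_iso_def
    by (intro exI[of _ h] conjI bij) (auto simp: h.add h.smult grade grade_shift_def algebra_simps)
  have coord_scalar_closed: "coord_scalar n W c \<in> carrier R" for c
    by (simp add: coord_scalar_def)
  \<comment> \<open>N and S/Y are the same additive group, and a constant acts on it alike through
    S/W and through S/Y. Hence both have the same bases.\<close>
  have "vdim (coord_scalar n W) N (coord_grade n Y e) = vdim (coord_scalar n Y) (self_module Y.A) (coord_grade n Y e)" for e
  proof -
    have "is_finite_basis (coord_scalar n W) N (coord_grade n Y e) B
        \<longleftrightarrow> is_finite_basis (coord_scalar n Y) (self_module Y.A) (coord_grade n Y e) B" for B
    proof (cases "B \<subseteq> coord_grade n Y e")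
      \<comment> \<open>The two actions are compared on the carrier only; a set B outside the
        component is a basis on neither side.\<close>
      case True
      then have B: "b \<in> carrier Y.A" if "b \<in> B" for b
        using that by (auto simp: coord_grade_def homog_part_closed)
      have smult: "coord_scalar n Y c \<odot>\<^bsub>self_module Y.A\<^esub> b = coord_scalar n W c \<odot>\<^bsub>N\<^esub> b" if "b \<in> B" for b c
        using B[OF that] by (auto simp: Y.carrier_A self_module_def coord_scalar_def N_smult Y.cls_simps)
      have "finsum (self_module Y.A) f B = finsum N f B" for f
        by (simp add: finsum_def N_simps self_module_def coord_module_def restrict_scalars_def)
      moreover have "finsum N (\<lambda>b. coord_scalar n Y (c b) \<odot>\<^bsub>self_module Y.A\<^esub> b) B
          = finsum N (\<lambda>b. coord_scalar n W (c b) \<odot>\<^bsub>N\<^esub> b) B" for c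
        by (rule N.finsum_cong') (use B smult coord_scalar_closed in \<open>auto simp: N_simps[symmetric] intro!: N.smult_closed\<close>)
      ultimately show ?thesis by (simp add: is_finite_basis_def)
    qed (auto simp: is_finite_basis_def)
    then show ?thesis by (simp add: vdim_def)
  qed
  moreover have "vdim (coord_scalar n W) N (h ` omega_grade n W (Suc n) i)
      = vdim (coord_scalar n W) L (omega_grade n W (Suc n) i)"
    by (rule h.vdim_image[OF bij omega_grade_closed]) (use constants_closed in blast)
  ultimately show "hilbert_function (coord_scalar n W) L (omega_grade n W (Suc n)) i =
      hilbert_function (coord_scalar n Y) (self_module (coord_ring n Y)) (coord_grade n Y) (i - int n - 1)"
    by (simp add: hilbert_function_def grade)
qed

end

section \<open>Fat points\<close>

context poly_ideal
begin

definition ideal_pow :: "nat \<Rightarrow> 'k mpoly set" where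
  "ideal_pow k = I [^]\<^bsub>ideals_set (poly_ring n)\<^esub> k"

lemma ideal_pow_0 [simp]: "ideal_pow 0 = carrier (poly_ring n)"
  and ideal_pow_Suc: "ideal_pow (Suc k) = ideal_prod (poly_ring n) (ideal_pow k) I"
  and ideal_pow_ideal: "ideal (ideal_pow k) (poly_ring n)"
proof -
  interpret m: comm_monoid "ideals_set (poly_ring n :: 'k mpoly ring)"
    by (rule poly_ring.ideals_set_is_comm_monoid)
  show "ideal_pow 0 = carrier (poly_ring n)" by (simp add: ideal_pow_def ideals_set_def)
  show "ideal_pow (Suc k) = ideal_prod (poly_ring n) (ideal_pow k) I" by (simp add: ideal_pow_def ideals_set_def)
  have "I \<in> carrier (ideals_set (poly_ring n))" using ideal by (simp add: ideals_set_def)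
  then have "ideal_pow k \<in> carrier (ideals_set (poly_ring n))"
    unfolding ideal_pow_def by (rule m.nat_pow_closed)
  then show "ideal (ideal_pow k) (poly_ring n)" by (simp add: ideals_set_def)
qed

lemma ideal_pow_poly_ideal: "poly_ideal n (ideal_pow k)"
  by (rule poly_ideal.intro) (rule ideal_pow_ideal)

lemma mult_ideal_pow: "F \<in> ideal_pow k \<Longrightarrow> G \<in> I \<Longrightarrow> F * G \<in> ideal_pow (Suc k)"
  using ideal_prod.prod[of F "ideal_pow k" G I "poly_ring n"] by (simp add: ideal_pow_Suc)

lemma power_mult_ideal_pow: "F \<in> ideal_pow a \<Longrightarrow> G \<in> I \<Longrightarrow> G ^ b * F \<in> ideal_pow (a + b)"
proof (induction b)
  case (Suc b)
  then show ?case using mult_ideal_pow[of "G ^ b * F" "a + b" G] by (simp add: mult_ac)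
qed simp

lemma ideal_pow_mono: "a \<le> b \<Longrightarrow> ideal_pow b \<subseteq> ideal_pow a"
proof (induction b rule: dec_induct)
  case (step b)
  have "ideal_pow (Suc b) \<subseteq> ideal_pow b"
    using poly_ring.ideal_prod_inter[OF ideal_pow_ideal ideal] by (auto simp: ideal_pow_Suc)
  with step.IH show ?case by blast
qed simp

text \<open>By the Leibniz rule on products G H with G in the k-th power and H in I: in G DH the
  factor G already suffices, and in H DG the factor H restores the power lost by DG. Truncation at k
  = 0 is harmless, as the power is then the whole ring.\<close>

lemma partial_deriv_ideal_pow:
  "F \<in> ideal_pow k \<Longrightarrow> partial_deriv j F \<in> ideal_pow (k - 1)"
proof (induction k arbitrary: F)
  case (Suc k)
  interpret P: poly_ideal n "ideal_pow k" by (rule ideal_pow_poly_ideal)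
  from Suc.prems show ?case
    unfolding ideal_pow_Suc
  proof (induction F rule: ideal_prod.induct)
    case (prod G H)
    have "G * partial_deriv j H \<in> ideal_pow k"
      using prod closed_carrier[of H] P.mult_in[of G "partial_deriv j H"] by (simp add: mult.commute)
    moreover have "H * partial_deriv j G \<in> ideal_pow k"
    \<comment> \<open>For k = 0 the target is the whole ring and the induction hypothesis offers no
      power from which H could lift.\<close>
    proof (cases k)
      case 0
      then show ?thesis using closed_carrier[OF prod(2)] P.closed_carrier[OF prod(1)] by simp
    next
      case (Suc l)
      then show ?thesis
        using mult_ideal_pow[of "partial_deriv j G" l H] Suc.IH[OF prod(1)] prod(2) by (simp add: mult.commute)
    qed
    ultimately show ?case by (simp add: partial_deriv_mult P.add_in)
  qed (simp add: partial_deriv_add P.add_in)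
qed simp

end

section \<open>Linear forms and the ideals of points\<close>

lemma poly_eval_superset:
  assumes "finite A" "Poly_Mapping.keys F \<subseteq> A"
  shows "poly_eval n p F =
    (\<Sum>\<alpha>\<in>A. Poly_Mapping.lookup F \<alpha> * (\<Prod>i\<le>n. p i ^ Poly_Mapping.lookup \<alpha> i))"
  unfolding poly_eval_def
  by (rule sum.mono_neutral_left) (use assms in \<open>auto simp: in_keys_iff\<close>)

definition linear_form :: "nat \<Rightarrow> (nat \<Rightarrow> 'k::field) \<Rightarrow> 'k mpoly" where
  "linear_form n a = (\<Sum>i\<le>n. poly_const (a i) * poly_var i)"

lemma linear_form_homog: "linear_form n a \<in> homog_part n 1"
  unfolding linear_form_def
  using homog_part_mult[OF homog_part_const homog_part_var] by (intro homog_part_sum) fastforce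

text \<open>Evaluation sums over the support, which misses the X_i with a_i = 0. The sum is
  therefore first enlarged to the exponents of all variables.\<close>

lemma poly_eval_linear_form: "poly_eval n p (linear_form n a) = (\<Sum>i\<le>n. a i * p i)"
proof -
  let ?e = "\<lambda>i. Poly_Mapping.single i (1::nat)"
  have form: "linear_form n a = (\<Sum>i\<le>n. Poly_Mapping.single (?e i) (a i))"
    by (simp add: linear_form_def poly_const_def poly_var_def mult_single)
  have inj: "inj_on ?e {..n}" by (rule inj_onI) (metis keys_single singleton_inject zero_neq_one)
  have lookup: "Poly_Mapping.lookup (linear_form n a) (?e i) = a i" if "i \<le> n" for i
  proof -
    have "Poly_Mapping.lookup (linear_form n a) (?e i) = (\<Sum>j\<le>n. if j = i then a j else 0)"
      unfolding form lookup_sum using inj that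
      by (intro sum.cong) (auto simp: lookup_single when_def dest: inj_onD)
    then show ?thesis using that by simp
  qed
  have "Poly_Mapping.keys (linear_form n a) \<subseteq> ?e ` {..n}"
    unfolding form using keys_sum[of "\<lambda>i. Poly_Mapping.single (?e i) (a i)" "{..n}"]
    by (auto split: if_splits)
  then have "poly_eval n p (linear_form n a) =
      (\<Sum>\<alpha>\<in>?e ` {..n}. Poly_Mapping.lookup (linear_form n a) \<alpha> * (\<Prod>i\<le>n. p i ^ Poly_Mapping.lookup \<alpha> i))"
    by (intro poly_eval_superset) auto
  also have "\<dots> = (\<Sum>j\<le>n. a j * (\<Prod>i\<le>n. p i ^ Poly_Mapping.lookup (?e j) i))"
    by (subst sum.reindex[OF inj]) (use lookup in simp)
  also have "\<dots> = (\<Sum>j\<le>n. a j * p j)"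
  proof (rule sum.cong)
    fix j assume "j \<in> {..n}"
    have "(\<Prod>i\<le>n. p i ^ Poly_Mapping.lookup (?e j) i) = (\<Prod>i\<le>n. if i = j then p i else 1)"
      by (rule prod.cong) (auto simp: lookup_single when_def)
    then show "a j * (\<Prod>i\<le>n. p i ^ Poly_Mapping.lookup (?e j) i) = a j * p j"
      using \<open>j \<in> {..n}\<close> by simp
  qed simp
  finally show ?thesis .
qed

lemma partial_deriv_sum: "partial_deriv j (sum f A) = (\<Sum>x\<in>A. partial_deriv j (f x))"
  by (induction A rule: infinite_finite_induct) (simp_all add: partial_deriv_add)

lemma partial_deriv_linear_form:
  assumes "j \<le> n"
  shows "partial_deriv j (linear_form n a) = poly_const (a j)"
proof -
  have "partial_deriv j (linear_form n a) = (\<Sum>i\<le>n. if i = j then poly_const (a i) else 0)"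
    unfolding linear_form_def partial_deriv_sum
    by (rule sum.cong) (auto simp: partial_deriv_mult partial_deriv_var)
  then show ?thesis using assms by simp
qed

lemma linear_form_in_point_ideal:
  assumes "(\<Sum>i\<le>n. a i * p i) = 0"
  shows "linear_form n a \<in> point_ideal n p"
proof -
  have "{F. (\<exists>d. F \<in> homog_part n d) \<and> poly_eval n p F = 0} \<subseteq> carrier (poly_ring n)"
    using homog_part_closed by blast
  from poly_ring.genideal_self[OF this] show ?thesis
    unfolding point_ideal_def using linear_form_homog poly_eval_linear_form[of n p a] assms by auto
qed

lemma point_ideal_poly_ideal: "poly_ideal n (point_ideal n p)"
  unfolding point_ideal_def
  by (intro poly_ideal.intro poly_ring.genideal_ideal) (use homog_part_closed in blast)

lemma fat_ideal_eq:
  "fat_ideal n s P m = (\<Inter>j\<in>{1..s}. poly_ideal.ideal_pow n (point_ideal n (P j)) (m j))"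
  by (simp add: fat_ideal_def poly_ideal.ideal_pow_def point_ideal_poly_ideal)

lemma fat_ideal_poly_ideal:
  assumes "s \<ge> 1"
  shows "poly_ideal n (fat_ideal n s P m)"
  unfolding fat_ideal_eq
  by (intro poly_ideal.intro poly_ring.i_Intersect)
    (use assms poly_ideal.ideal_pow_ideal[OF point_ideal_poly_ideal] in auto)

lemma fat_ideal_deriv_gen:
  fixes P :: "nat \<Rightarrow> nat \<Rightarrow> 'k::field_char_0"
  assumes hyperplane: "in_hyperplane n (P ` {1..s})" and "s \<ge> 1"
    and J: "ideal J (poly_ring n)"
    and deriv: "\<And>F k. F \<in> fat_ideal n s P m \<Longrightarrow> k \<le> n \<Longrightarrow> partial_deriv k F \<in> J"
    and F: "F \<in> fat_ideal n s P (\<lambda>j. m j - 1)"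
  shows "F \<in> J"
proof -
  interpret J: poly_ideal n J by (rule poly_ideal.intro) (rule J)
  from hyperplane obtain a k where k: "k \<le> n" "a k \<noteq> 0"
    and a: "\<And>j. j \<in> {1..s} \<Longrightarrow> (\<Sum>i\<le>n. a i * P j i) = 0"
    by (auto simp: in_hyperplane_def)
  define l where "l = linear_form n a"
  have l: "l \<in> carrier (poly_ring n)" "partial_deriv k l = poly_const (a k)"
    using homog_part_closed[OF linear_form_homog] partial_deriv_linear_form[OF k(1)] by (auto simp: l_def)
  have pow: "(partial_deriv k ^^ r) F \<in> poly_ideal.ideal_pow n (point_ideal n (P j)) (m j - 1 - r)"
    if "j \<in> {1..s}" for r j
  proof (induction r)
    case 0
    show ?case using F that by (simp add: fat_ideal_eq)
  next
    case (Suc r)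
    then show ?case
      using poly_ideal.partial_deriv_ideal_pow[OF point_ideal_poly_ideal Suc.IH, of k] by simp
  qed
  have step: "l ^ r * (partial_deriv k ^^ r) F \<in> J"
    if IH: "l ^ Suc r * (partial_deriv k ^^ Suc r) F \<in> J" for r
  proof -
    let ?G = "(partial_deriv k ^^ r) F"
    have "l ^ Suc r * ?G \<in> poly_ideal.ideal_pow n (point_ideal n (P j)) (m j)" if j: "j \<in> {1..s}" for j
    proof -
      interpret Q: poly_ideal n "point_ideal n (P j)" by (rule point_ideal_poly_ideal)
      have "l \<in> point_ideal n (P j)" unfolding l_def by (rule linear_form_in_point_ideal) (rule a[OF j])
      then have "l ^ Suc r * ?G \<in> Q.ideal_pow (m j - 1 - r + Suc r)"
        using pow[OF j] by (intro Q.power_mult_ideal_pow)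
      \<comment> \<open>Equality holds for r < m j. From then on the subtraction is truncated, and
        the r + 1 factors l suffice by themselves.\<close>
      moreover have "m j \<le> m j - 1 - r + Suc r" by linarith
      ultimately show ?thesis using Q.ideal_pow_mono by blast
    qed
    then have "partial_deriv k (l ^ Suc r * ?G) \<in> J"
      by (intro deriv k) (simp add: fat_ideal_eq)
    \<comment> \<open>The first summand is the one that \<open>IH\<close> puts into J, so the second
      lies in J as well.\<close>
    then have "l ^ Suc r * partial_deriv k ?G + ?G * (of_nat (Suc r) * l ^ r * poly_const (a k)) \<in> J"
      by (simp only: partial_deriv_mult partial_deriv_power l(2))
    then have "?G * (of_nat (Suc r) * l ^ r * poly_const (a k)) \<in> J"
      using J.minus_in[OF _ IH] by fastforce
    \<comment> \<open>The factor r + 1 is written as a constant polynomial, so that it can be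
      cancelled together with \<open>a k\<close>: the multiplier below is the inverse of their
      product in K, which exists in characteristic zero.\<close>
    moreover have "of_nat (Suc r) = (poly_const (of_nat (Suc r)) :: 'k mpoly)"
      unfolding poly_const_def by (rule single_of_nat[symmetric])
    ultimately have "?G * (poly_const (of_nat (Suc r)) * l ^ r * poly_const (a k)) \<in> J"
      by (simp only:)
    then have "poly_const (1 / (of_nat (Suc r) * a k))
        * (?G * (poly_const (of_nat (Suc r)) * l ^ r * poly_const (a k))) \<in> J"
      by (rule J.mult_in) (rule poly_const_closed)
    moreover have "poly_const (1 / (of_nat (Suc r) * a k))
        * (?G * (poly_const (of_nat (Suc r)) * l ^ r * poly_const (a k)))
        = poly_const (1 / (of_nat (Suc r) * a k) * (of_nat (Suc r) * a k)) * (l ^ r * ?G)"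
      by (simp only: poly_const_simps mult_ac)
    moreover have "1 / (of_nat (Suc r) * a k) * (of_nat (Suc r) * a k) = 1"
      using k(2) by (simp del: of_nat_Suc)
    ultimately show ?thesis by (simp only: poly_const_simps(2) mult_1)
  qed
  \<comment> \<open>Here R bounds the degree of F in X_k. Starting from 0 in J, R applications of
    \<open>step\<close> lead down to exponent 0, where the product is F itself.\<close>
  obtain R where "(partial_deriv k ^^ R) F = 0" using partial_deriv_nilpotent by blast
  then have "l ^ R * (partial_deriv k ^^ R) F \<in> J" by simp
  then have "l ^ 0 * (partial_deriv k ^^ 0) F \<in> J"
    by (induction R) (use step in blast)+
  then show ?thesis by simp
qed

lemma fat_ideal_pair:
  fixes P :: "nat \<Rightarrow> nat \<Rightarrow> 'k::field_char_0"
  assumes "in_hyperplane n (P ` {1..s})" "s \<ge> 1"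
  shows "poly_ideal_pair n (fat_ideal n s P m) (fat_ideal n s P (\<lambda>j. m j - 1))"
proof (intro poly_ideal_pair.intro poly_ideal_pair_axioms.intro fat_ideal_poly_ideal assms(2))
  show "fat_ideal n s P m \<subseteq> fat_ideal n s P (\<lambda>j. m j - 1)"
    unfolding fat_ideal_eq
    by (intro INF_mono' poly_ideal.ideal_pow_mono[OF point_ideal_poly_ideal]) simp
  show "partial_deriv j F \<in> fat_ideal n s P (\<lambda>j. m j - 1)" if "F \<in> fat_ideal n s P m" for F j
    using that unfolding fat_ideal_eq
    by (intro INT_I poly_ideal.partial_deriv_ideal_pow[OF point_ideal_poly_ideal]) blast
  show "F \<in> J" if "ideal J (poly_ring n)"
    and "\<And>F j. F \<in> fat_ideal n s P m \<Longrightarrow> j \<le> n \<Longrightarrow> partial_deriv j F \<in> J"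
    and "F \<in> fat_ideal n s P (\<lambda>j. m j - 1)" for J F
    using fat_ideal_deriv_gen[OF assms that] .
qed

theorem proposition8p1:
  fixes n s :: nat
    and P :: "nat \<Rightarrow> nat \<Rightarrow> 'k::field_char_0"
    and m :: "nat \<Rightarrow> nat"
    and W Y :: "'k mpoly set"
  assumes "n \<ge> 1" and "s \<ge> 1"
    and "\<forall>j\<in>{1..s}. P j 0 \<noteq> 0"
    and "\<forall>j\<in>{1..s}. \<forall>k\<in>{1..s}. j \<noteq> k \<longrightarrow> \<not> same_point n (P j) (P k)"
    and "\<forall>j\<in>{1..s}. m j \<ge> 1"
    and "in_hyperplane n (P ` {1..s})"
    and "W = fat_ideal n s P m"
    and "Y = fat_ideal n s P (\<lambda>j. m j - 1)"
  shows "graded_module_iso (coord_ring n W)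
           (omega n W (n + 1)) (omega_grade n W (n + 1))
           (coord_module n W Y) (grade_shift (coord_grade n Y) (- int n - 1))
       \<and> (\<forall>i::int.
           hilbert_function (coord_scalar n W) (omega n W (n + 1)) (omega_grade n W (n + 1)) i
           = hilbert_function (coord_scalar n Y) (self_module (coord_ring n Y)) (coord_grade n Y)
               (i - int n - 1))"
proof -
  interpret poly_ideal_pair n W Y
    unfolding assms(7,8) by (rule fat_ideal_pair) (use assms in auto)
  show ?thesis
    using top_forms_graded_iso hilbert_function_top_forms by simp
qed

end
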